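(* Let $M$ be a compact even-dimensional manifold with boundary with an action of a compact Lie group $G$, let $g$ be a $G$-invariant Riemannian metric on $M$ and let $g_0$ be a $G$-invariant Riemannian metric on $M$ which is a product near the boundary and satisfies $g_0|_{\partial M}=g|_{\partial M}$. Let $\nabla^1,\nabla^0$ be the Levi-Civita connections of $g$ and $g_0$, $\Theta=\nabla^1-\nabla^0$, and $\nabla^t=\nabla^0+t\Theta$ for $0\le t\le1$, with curvature $R^t$. Then the (geometric) degree $3$ component of the equivariant transgression form $TL_{\mathfrak g}(g,g_0)(X)$ of the Hirzebruch $L$-form for the family $\nabla^t$ is given by $$TL_{\mathfrak g}(g,g_0)(X)_{[3]}=\int_0^1\exp\big(\operatorname{Tr}[f(\nabla^tX)]\big)\cdot\Big(\operatorname{Tr}[\Theta f'(\nabla^tX)]\cdot\operatorname{Tr}[f'(\nabla^tX)R^t]+\operatorname{Tr}\big[(f^{[2]}(\nabla^tX)*\Theta)R^t\big]\Big)\,dt.$$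
   Context: $\mathfrak g$ is the Lie algebra of $G$; for $X\in\mathfrak g$ the vector field $X_M(x)=\frac{d}{ds}|_{s=0}\exp(-sX)\cdot x$ is also denoted $X$, and $\nabla^tX$ is the endomorphism $Y\mapsto\nabla^t_YX$ of $TM$. Throughout $X$ is small enough for the power series to converge. A metric is a product near the boundary if on some part $\partial M\times[a,0]$, $a<0$, of a fixed $G$-equivariant collar $\partial M\times(-\infty,0]$ it is the product of its restriction to $\partial M$ and the standard metric. The equivariant curvature of $\nabla^t$ is $R^t_{\mathfrak g}(X)=R^t-\nabla^tX$. Put $\tilde f(x)=\frac{x/2}{\tanh(x/2)}$ and $f=\frac12\log\tilde f$ (an even function analytic near $0$). Then $L_{\mathfrak g}(\nabla^t)(X)=\det^{1/2}\tilde f(R^t_{\mathfrak g}(X))=\exp(\operatorname{Tr}[f(R^t_{\mathfrak g}(X))])$ and $$TL_{\mathfrak g}(g,g_0)(X)=\int_0^1\exp\big(\operatorname{Tr}[f(R^t_{\mathfrak g}(X))]\big)\cdot\operatorname{Tr}\big[\Theta f'(R^t_{\mathfrak g}(X))\big]\,dt .$$ For an equivariant form $\omega$ (a form-valued function of $X$), $\omega_{[k]}$ denotes its component of differential-form degree $k$ on $M$. For non-commuting variables $a,b$ put $H_n(a,b)=\sum_{q=0}^{n-1}a^qba^{n-1-q}$ and $$f^{[2]}(a)*b=\sum_{n=0}^\infty\frac1{n!}f^{(n+1)}(0)\,H_n(a,b).$$ *)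

theory Defs
  imports "HOL-Analysis.Analysis" "HOL-Algebra.Group_Action"
begin

section \<open>Smooth manifolds with boundary\<close>

primrec times_cont_diff :: "nat \<Rightarrow> 'a::euclidean_space set \<Rightarrow> ('a \<Rightarrow> 'b::real_normed_vector) \<Rightarrow> bool" where
  "times_cont_diff 0 U f \<longleftrightarrow> continuous_on U f"
| "times_cont_diff (Suc k) U f \<longleftrightarrow>
     f differentiable_on U \<and> (\<forall>v. times_cont_diff k U (\<lambda>x. frechet_derivative f (at x) v))"

text \<open>Smoothness on an arbitrary subset means local smooth extendability to open sets; on relatively
  open subsets of a half-space this is smoothness up to the boundary.\<close>

definition smooth_on :: "'a::euclidean_space set \<Rightarrow> ('a \<Rightarrow> 'b::real_normed_vector) \<Rightarrow> bool" where
  "smooth_on A f \<longleftrightarrow>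
     (\<forall>x\<in>A. \<exists>U F. open U \<and> x \<in> U \<and> (\<forall>k. times_cont_diff k U F) \<and> (\<forall>y\<in>A \<inter> U. f y = F y))"

text \<open>A manifold is a topological space (a whole type) with an atlas. Charts take values in
  relatively open subsets of a model set \<open>H\<close>: a half-space for manifolds with boundary, a linear
  subspace (possibly \<open>{0}\<close>) for manifolds without boundary of arbitrary dimension.\<close>

type_synonym ('a, 'e) chart = "'a set \<times> ('a \<Rightarrow> 'e)"

definition is_chart :: "'e::euclidean_space set \<Rightarrow> ('a::topological_space, 'e) chart \<Rightarrow> bool" where
  "is_chart H = (\<lambda>(U, \<phi>). open U \<and> openin (top_of_set H) (\<phi> ` U) \<and>
     homeomorphism U (\<phi> ` U) \<phi> (inv_into U \<phi>))"

definition smooth_atlas :: "'e::euclidean_space set \<Rightarrow> ('a::topological_space, 'e) chart set \<Rightarrow> bool" where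
  "smooth_atlas H \<A> \<longleftrightarrow>
     (\<forall>c\<in>\<A>. is_chart H c) \<and> (\<Union>(U, \<phi>)\<in>\<A>. U) = UNIV \<and>
     (\<forall>(U, \<phi>)\<in>\<A>. \<forall>(V, \<psi>)\<in>\<A>. smooth_on (\<phi> ` (U \<inter> V)) (\<psi> \<circ> inv_into U \<phi>))"

definition half_space :: "'n::finite \<Rightarrow> (real^'n) set" where
  "half_space k = {x. x $ k \<le> 0}"

definition bdry :: "'n::finite \<Rightarrow> ('a, real^'n) chart set \<Rightarrow> 'a set" where
  "bdry k \<A> = {x. \<exists>(U, \<phi>)\<in>\<A>. x \<in> U \<and> \<phi> x $ k = 0}"

definition smooth_map ::
  "('a::topological_space, 'e::euclidean_space) chart set \<Rightarrow>
   ('b::topological_space, 'f::euclidean_space) chart set \<Rightarrow> 'a set \<Rightarrow> ('a \<Rightarrow> 'b) \<Rightarrow> bool" where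
  "smooth_map \<A> \<B> S F \<longleftrightarrow> continuous_on S F \<and>
     (\<forall>(U, \<phi>)\<in>\<A>. \<forall>(V, \<psi>)\<in>\<B>.
        smooth_on (\<phi> ` {p \<in> S \<inter> U. F p \<in> V}) (\<psi> \<circ> F \<circ> inv_into U \<phi>))"

definition prod_atlas :: "('a, 'e) chart set \<Rightarrow> ('b, 'f) chart set \<Rightarrow> ('a \<times> 'b, 'e \<times> 'f) chart set" where
  "prod_atlas \<A> \<B> = (\<lambda>((U, \<phi>), (V, \<psi>)). (U \<times> V, map_prod \<phi> \<psi>)) ` (\<A> \<times> \<B>)"

definition real_atlas :: "(real, real) chart set" where
  "real_atlas = {(UNIV, id)}"

definition smooth_functions ::
  "('a::topological_space, 'e::euclidean_space) chart set \<Rightarrow> 'a set \<Rightarrow> ('a \<Rightarrow> real) set" where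
  "smooth_functions \<A> S = {h. smooth_map \<A> real_atlas S h}"

section \<open>Tangent vectors and vector fields\<close>

text \<open>The tangent space at \<open>x\<close> of the submanifold \<open>S\<close> consists of the derivations at \<open>x\<close> of the
  algebra of smooth functions on \<open>S\<close>. As functions on \<open>S\<close> are represented by total functions, a
  derivation must not depend on values off \<open>S\<close>; it is set to 0 on non-smooth arguments.\<close>

type_synonym 'a tangent_vector = "('a \<Rightarrow> real) \<Rightarrow> real"
type_synonym 'a vfield = "'a \<Rightarrow> 'a tangent_vector"

definition tangent_space ::
  "('a::topological_space, 'e::euclidean_space) chart set \<Rightarrow> 'a set \<Rightarrow> 'a \<Rightarrow> 'a tangent_vector set" where
  "tangent_space \<A> S x = {v.
     (\<forall>h\<in>smooth_functions \<A> S. \<forall>h'\<in>smooth_functions \<A> S.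
        (\<forall>a b. v (\<lambda>y. a * h y + b * h' y) = a * v h + b * v h') \<and>
        v (\<lambda>y. h y * h' y) = v h * h' x + h x * v h' \<and>
        ((\<forall>y\<in>S. h y = h' y) \<longrightarrow> v h = v h')) \<and>
     (\<forall>h. h \<notin> smooth_functions \<A> S \<longrightarrow> v h = 0)}"

definition vfields :: "('a::topological_space, 'e::euclidean_space) chart set \<Rightarrow> 'a vfield set" where
  "vfields \<A> = {Y. (\<forall>x. Y x \<in> tangent_space \<A> UNIV x) \<and>
     (\<forall>h\<in>smooth_functions \<A> UNIV. (\<lambda>x. Y x h) \<in> smooth_functions \<A> UNIV)}"

text \<open>The differential of a map \<open>F\<close> into the manifold with atlas \<open>\<A>\<close>, on tangent vectors.\<close>

definition push ::
  "('b::topological_space, 'e::euclidean_space) chart set \<Rightarrow> ('a \<Rightarrow> 'b) \<Rightarrow>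
   'a tangent_vector \<Rightarrow> 'b tangent_vector" where
  "push \<A> F v = (\<lambda>h. if h \<in> smooth_functions \<A> UNIV then v (h \<circ> F) else 0)"

definition lie_bracket :: "'a vfield \<Rightarrow> 'a vfield \<Rightarrow> 'a vfield" where
  "lie_bracket Y Z = (\<lambda>x h. Y x (\<lambda>y. Z y h) - Z x (\<lambda>y. Y y h))"

section \<open>Metrics, connections and curvature\<close>

type_synonym 'a metric_tensor = "'a \<Rightarrow> 'a tangent_vector \<Rightarrow> 'a tangent_vector \<Rightarrow> real"
type_synonym 'a connection = "'a vfield \<Rightarrow> 'a vfield \<Rightarrow> 'a vfield"

definition riemannian_metric ::
  "('a::topological_space, 'e::euclidean_space) chart set \<Rightarrow> 'a metric_tensor \<Rightarrow> bool" where
  "riemannian_metric \<A> g \<longleftrightarrow>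
     (\<forall>x. \<forall>u\<in>tangent_space \<A> UNIV x. \<forall>v\<in>tangent_space \<A> UNIV x. \<forall>w\<in>tangent_space \<A> UNIV x.
        g x v w = g x w v \<and>
        (\<forall>a b. g x (\<lambda>h. a * u h + b * v h) w = a * g x u w + b * g x v w) \<and>
        (v \<noteq> (\<lambda>h. 0) \<longrightarrow> g x v v > 0)) \<and>
     (\<forall>Y\<in>vfields \<A>. \<forall>Z\<in>vfields \<A>. (\<lambda>x. g x (Y x) (Z x)) \<in> smooth_functions \<A> UNIV)"

text \<open>\<open>D Y Z\<close> is the covariant derivative of \<open>Z\<close> in the direction \<open>Y\<close>.\<close>

definition is_connection ::
  "('a::topological_space, 'e::euclidean_space) chart set \<Rightarrow> 'a connection \<Rightarrow> bool" where
  "is_connection \<A> D \<longleftrightarrow>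
     (\<forall>Y\<in>vfields \<A>. \<forall>Z\<in>vfields \<A>. D Y Z \<in> vfields \<A>) \<and>
     (\<forall>Y\<in>vfields \<A>. \<forall>Y'\<in>vfields \<A>. \<forall>Z\<in>vfields \<A>.
        \<forall>p\<in>smooth_functions \<A> UNIV. \<forall>q\<in>smooth_functions \<A> UNIV.
        D (\<lambda>x h. p x * Y x h + q x * Y' x h) Z = (\<lambda>x h. p x * D Y Z x h + q x * D Y' Z x h)) \<and>
     (\<forall>Y\<in>vfields \<A>. \<forall>Z\<in>vfields \<A>. \<forall>Z'\<in>vfields \<A>.
        D Y (\<lambda>x h. Z x h + Z' x h) = (\<lambda>x h. D Y Z x h + D Y Z' x h)) \<and>
     (\<forall>Y\<in>vfields \<A>. \<forall>Z\<in>vfields \<A>. \<forall>p\<in>smooth_functions \<A> UNIV.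
        D Y (\<lambda>x h. p x * Z x h) = (\<lambda>x h. Y x p * Z x h + p x * D Y Z x h))"

definition levi_civita ::
  "('a::topological_space, 'e::euclidean_space) chart set \<Rightarrow> 'a metric_tensor \<Rightarrow> 'a connection \<Rightarrow> bool" where
  "levi_civita \<A> g D \<longleftrightarrow> is_connection \<A> D \<and>
     (\<forall>Y\<in>vfields \<A>. \<forall>Z\<in>vfields \<A>. (\<lambda>x h. D Y Z x h - D Z Y x h) = lie_bracket Y Z) \<and>
     (\<forall>Y\<in>vfields \<A>. \<forall>Z\<in>vfields \<A>. \<forall>W\<in>vfields \<A>. \<forall>x.
        Y x (\<lambda>y. g y (Z y) (W y)) = g x (D Y Z x) (W x) + g x (Z x) (D Y W x))"

definition conn_diff :: "'a connection \<Rightarrow> 'a connection \<Rightarrow> 'a connection" where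
  "conn_diff D1 D0 = (\<lambda>Y Z x h. D1 Y Z x h - D0 Y Z x h)"

definition conn_path :: "'a connection \<Rightarrow> 'a connection \<Rightarrow> real \<Rightarrow> 'a connection" where
  "conn_path D1 D0 t = (\<lambda>Y Z x h. D0 Y Z x h + t * conn_diff D1 D0 Y Z x h)"

definition curvature :: "'a connection \<Rightarrow> 'a vfield \<Rightarrow> 'a vfield \<Rightarrow> 'a vfield \<Rightarrow> 'a vfield" where
  "curvature D Y Z W = (\<lambda>x h. D Y (D Z W) x h - D Z (D Y W) x h - D (lie_bracket Y Z) W x h)"

section \<open>Lie group actions\<close>

definition lie_group ::
  "'e::euclidean_space set \<Rightarrow> ('g::t2_space, 'e) chart set \<Rightarrow> ('g, 'z) monoid_scheme \<Rightarrow> bool" where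
  "lie_group V \<B> \<G> \<longleftrightarrow> subspace V \<and> smooth_atlas V \<B> \<and> group \<G> \<and> carrier \<G> = UNIV \<and>
     smooth_map (prod_atlas \<B> \<B>) \<B> UNIV (\<lambda>(a, b). a \<otimes>\<^bsub>\<G>\<^esub> b) \<and>
     smooth_map \<B> \<B> UNIV (\<lambda>a. inv\<^bsub>\<G>\<^esub> a)"

definition lie_algebra ::
  "('g::topological_space, 'e::euclidean_space) chart set \<Rightarrow> ('g, 'z) monoid_scheme \<Rightarrow> 'g tangent_vector set" where
  "lie_algebra \<B> \<G> = tangent_space \<B> UNIV \<one>\<^bsub>\<G>\<^esub>"

definition one_parameter_subgroup ::
  "('g::topological_space, 'e::euclidean_space) chart set \<Rightarrow> ('g, 'z) monoid_scheme \<Rightarrow>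
   'g tangent_vector \<Rightarrow> (real \<Rightarrow> 'g) \<Rightarrow> bool" where
  "one_parameter_subgroup \<B> \<G> X \<gamma> \<longleftrightarrow>
     smooth_map real_atlas \<B> UNIV \<gamma> \<and> (\<forall>s t. \<gamma> (s + t) = \<gamma> s \<otimes>\<^bsub>\<G>\<^esub> \<gamma> t) \<and>
     (\<forall>h\<in>smooth_functions \<B> UNIV. ((h \<circ> \<gamma>) has_real_derivative X h) (at 0))"

definition lie_exp ::
  "('g::topological_space, 'e::euclidean_space) chart set \<Rightarrow> ('g, 'z) monoid_scheme \<Rightarrow>
   'g tangent_vector \<Rightarrow> 'g" where
  "lie_exp \<B> \<G> X = (THE \<gamma>. one_parameter_subgroup \<B> \<G> X \<gamma>) 1"

definition smooth_action ::
  "('a::topological_space, 'd::euclidean_space) chart set \<Rightarrow>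
   ('g::topological_space, 'e::euclidean_space) chart set \<Rightarrow>
   ('g, 'z) monoid_scheme \<Rightarrow> ('g \<Rightarrow> 'a \<Rightarrow> 'a) \<Rightarrow> bool" where
  "smooth_action \<A> \<B> \<G> act \<longleftrightarrow> group_action \<G> UNIV act \<and>
     smooth_map (prod_atlas \<B> \<A>) \<A> UNIV (\<lambda>(a, x). act a x)"

text \<open>\<open>X\<^sub>M(x) = d/ds exp(-sX)x\<close> at \<open>s = 0\<close>, as a derivation.\<close>

definition fundamental_vfield ::
  "('a::topological_space, 'd::euclidean_space) chart set \<Rightarrow>
   ('g::topological_space, 'e::euclidean_space) chart set \<Rightarrow>
   ('g, 'z) monoid_scheme \<Rightarrow> ('g \<Rightarrow> 'a \<Rightarrow> 'a) \<Rightarrow> 'g tangent_vector \<Rightarrow> 'a vfield" where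
  "fundamental_vfield \<A> \<B> \<G> act X = (\<lambda>x h. if h \<in> smooth_functions \<A> UNIV
     then deriv (\<lambda>s. h (act (lie_exp \<B> \<G> (\<lambda>k. - s * X k)) x)) 0 else 0)"

definition invariant_metric ::
  "('a::topological_space, 'd::euclidean_space) chart set \<Rightarrow> ('g \<Rightarrow> 'a \<Rightarrow> 'a) \<Rightarrow> 'a metric_tensor \<Rightarrow> bool" where
  "invariant_metric \<A> act g \<longleftrightarrow>
     (\<forall>a x. \<forall>v\<in>tangent_space \<A> UNIV x. \<forall>w\<in>tangent_space \<A> UNIV x.
        g (act a x) (push \<A> (act a) v) (push \<A> (act a) w) = g x v w)"

text \<open>A collar is a diffeomorphism \<open>c\<close> of \<open>\<partial>M \<times> (-\<infinity>, 0]\<close> onto an open neighbourhood of \<open>\<partial>M\<close>.\<close>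

definition equivariant_collar ::
  "'n::finite \<Rightarrow> ('a::topological_space, real^'n) chart set \<Rightarrow> ('g \<Rightarrow> 'a \<Rightarrow> 'a) \<Rightarrow> ('a \<times> real \<Rightarrow> 'a) \<Rightarrow> bool" where
  "equivariant_collar k \<A> act c \<longleftrightarrow>
     (let N = bdry k \<A> \<times> {..0::real}; \<A>' = prod_atlas \<A> real_atlas in
        smooth_map \<A>' \<A> N c \<and> inj_on c N \<and> open (c ` N) \<and>
        smooth_map \<A> \<A>' (c ` N) (inv_into N c)) \<and>
     (\<forall>y\<in>bdry k \<A>. c (y, 0) = y) \<and>
     (\<forall>a. \<forall>y\<in>bdry k \<A>. \<forall>s\<le>0. c (act a y, s) = act a (c (y, s)))"

text \<open>For \<open>w\<close> tangent to \<open>\<partial>M \<times> (-\<infinity>, 0]\<close>, \<open>push \<A> fst w\<close> is its \<open>\<partial>M\<close>-component, regarded as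
  a tangent vector of \<open>M\<close>, and \<open>w snd\<close> is its component in the \<open>(-\<infinity>, 0]\<close>-direction.\<close>

definition product_near_boundary ::
  "'n::finite \<Rightarrow> ('a::topological_space, real^'n) chart set \<Rightarrow> ('a \<times> real \<Rightarrow> 'a) \<Rightarrow> 'a metric_tensor \<Rightarrow> bool" where
  "product_near_boundary k \<A> c g \<longleftrightarrow>
     (\<exists>a<0. \<forall>y\<in>bdry k \<A>. \<forall>s\<in>{a..0}.
        \<forall>w\<in>tangent_space (prod_atlas \<A> real_atlas) (bdry k \<A> \<times> {..0}) (y, s).
        \<forall>w'\<in>tangent_space (prod_atlas \<A> real_atlas) (bdry k \<A> \<times> {..0}) (y, s).
          g (c (y, s)) (push \<A> c w) (push \<A> c w') =
          g y (push \<A> fst w) (push \<A> fst w') + w snd * w' snd)"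

definition same_boundary_metric ::
  "'n::finite \<Rightarrow> ('a::topological_space, real^'n) chart set \<Rightarrow> 'a metric_tensor \<Rightarrow> 'a metric_tensor \<Rightarrow> bool" where
  "same_boundary_metric k \<A> g g' \<longleftrightarrow>
     (\<forall>y\<in>bdry k \<A>. \<forall>v\<in>tangent_space \<A> (bdry k \<A>) y. \<forall>w\<in>tangent_space \<A> (bdry k \<A>) y.
        g y (push \<A> id v) (push \<A> id w) = g' y (push \<A> id v) (push \<A> id w))"

section \<open>The exterior algebra\<close>

text \<open>The real exterior algebra on generators indexed by \<open>'n\<close>: an element is given by its
  coefficients with respect to the monomials \<open>e\<^sub>A\<close>, the product of the generators with index in
  \<open>A\<close> in increasing order. Then \<open>e\<^sub>A e\<^sub>B\<close> vanishes unless \<open>A\<close> and \<open>B\<close> are disjoint, in which case it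
  is \<open>e\<close> at \<open>A \<union> B\<close> up to the sign given by the number of inversions.\<close>

typedef 'n exterior = "UNIV :: ('n set \<Rightarrow> real) set"
  morphisms ext_coeff Ext ..

lemmas ext_coeff_Ext [simp] = Ext_inverse[OF UNIV_I]

lemma exterior_eqI: "(\<And>A. ext_coeff x A = ext_coeff y A) \<Longrightarrow> x = y"
  by (metis ext ext_coeff_inject)

definition wedge_const :: "'n::{finite,linorder} set \<Rightarrow> 'n set \<Rightarrow> 'n set \<Rightarrow> real" where
  "wedge_const A B C = (if A \<inter> B = {} \<and> A \<union> B = C
     then (-1) ^ card {(a, b). a \<in> A \<and> b \<in> B \<and> b < a} else 0)"

lemma wedge_const_abs_sum: "(\<Sum>C\<in>UNIV. \<bar>wedge_const A B C\<bar>) \<le> 1"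
proof -
  have "(\<Sum>C\<in>UNIV. \<bar>wedge_const A B C\<bar>) = (\<Sum>C\<in>UNIV. if C = A \<union> B then (if A \<inter> B = {} then 1 else 0) else 0)"
    by (rule sum.cong) (auto simp: wedge_const_def)
  then show ?thesis by (simp add: sum.delta)
qed

lemma card_inversions_Un_left:
  fixes A B C :: "'n::{finite,linorder} set"
  assumes "A \<inter> B = {}"
  shows "card {(a, b). a \<in> A \<union> B \<and> b \<in> C \<and> b < a} =
    card {(a, b). a \<in> A \<and> b \<in> C \<and> b < a} + card {(a, b). a \<in> B \<and> b \<in> C \<and> b < a}"
proof -
  have "{(a, b). a \<in> A \<union> B \<and> b \<in> C \<and> b < a} =
    {(a, b). a \<in> A \<and> b \<in> C \<and> b < a} \<union> {(a, b). a \<in> B \<and> b \<in> C \<and> b < a}" by auto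
  then show ?thesis using assms by (simp only:) (rule card_Un_disjoint, auto)
qed

lemma card_inversions_Un_right:
  fixes A B C :: "'n::{finite,linorder} set"
  assumes "B \<inter> C = {}"
  shows "card {(a, b). a \<in> A \<and> b \<in> B \<union> C \<and> b < a} =
    card {(a, b). a \<in> A \<and> b \<in> B \<and> b < a} + card {(a, b). a \<in> A \<and> b \<in> C \<and> b < a}"
proof -
  have "{(a, b). a \<in> A \<and> b \<in> B \<union> C \<and> b < a} =
    {(a, b). a \<in> A \<and> b \<in> B \<and> b < a} \<union> {(a, b). a \<in> A \<and> b \<in> C \<and> b < a}" by auto
  then show ?thesis using assms by (simp only:) (rule card_Un_disjoint, auto)
qed

lemma wedge_const_assoc:
  "(\<Sum>E\<in>UNIV. wedge_const A B E * wedge_const E C D) = (\<Sum>E\<in>UNIV. wedge_const A E D * wedge_const B C E)"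
proof -
  have "(\<Sum>E\<in>UNIV. wedge_const A B E * wedge_const E C D) =
     (\<Sum>E\<in>UNIV. if E = A \<union> B then wedge_const A B (A \<union> B) * wedge_const (A \<union> B) C D else 0)"
    by (rule sum.cong) (auto simp: wedge_const_def)
  moreover have "(\<Sum>E\<in>UNIV. wedge_const A E D * wedge_const B C E) =
     (\<Sum>E\<in>UNIV. if E = B \<union> C then wedge_const A (B \<union> C) D * wedge_const B C (B \<union> C) else 0)"
    by (rule sum.cong) (auto simp: wedge_const_def)
  moreover have "wedge_const A B (A \<union> B) * wedge_const (A \<union> B) C D =
     wedge_const A (B \<union> C) D * wedge_const B C (B \<union> C)"
  proof (cases "A \<inter> B = {} \<and> B \<inter> C = {} \<and> A \<inter> C = {} \<and> A \<union> B \<union> C = D")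
    case True
    then show ?thesis
      using card_inversions_Un_left[of A B C] card_inversions_Un_right[of B C A]
      by (simp add: wedge_const_def Int_Un_distrib Int_Un_distrib2 Un_assoc power_add)
  next
    case False
    then show ?thesis by (auto simp: wedge_const_def)
  qed
  ultimately show ?thesis by simp
qed

instantiation exterior :: (type) real_vector
begin
definition "0 = Ext (\<lambda>A. 0)"
definition "x + y = Ext (\<lambda>A. ext_coeff x A + ext_coeff y A)"
definition "x - y = Ext (\<lambda>A. ext_coeff x A - ext_coeff y A)"
definition "- x = Ext (\<lambda>A. - ext_coeff x A)"
definition "c *\<^sub>R x = Ext (\<lambda>A. c * ext_coeff x A)"
instance
  by standard (rule exterior_eqI; simp add: zero_exterior_def plus_exterior_def minus_exterior_def
    uminus_exterior_def scaleR_exterior_def algebra_simps)+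
end

lemma ext_coeff_simps [simp]:
  "ext_coeff 0 A = 0" "ext_coeff (x + y) A = ext_coeff x A + ext_coeff y A"
  "ext_coeff (x - y) A = ext_coeff x A - ext_coeff y A" "ext_coeff (- x) A = - ext_coeff x A"
  "ext_coeff (c *\<^sub>R x) A = c * ext_coeff x A"
  by (simp_all add: zero_exterior_def plus_exterior_def minus_exterior_def
    uminus_exterior_def scaleR_exterior_def)

instantiation exterior :: ("{finite,linorder}") real_algebra_1
begin
definition "1 = Ext (\<lambda>A. if A = {} then 1 else 0)"
definition "x * y = Ext (\<lambda>C. \<Sum>A\<in>UNIV. \<Sum>B\<in>UNIV. wedge_const A B C * ext_coeff x A * ext_coeff y B)"

instance
proof
  fix x y z :: "'a exterior" and c :: real
  show "x * y * z = x * (y * z)"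
  proof (rule exterior_eqI)
    fix D
    have "ext_coeff (x * y * z) D = (\<Sum>E\<in>UNIV. \<Sum>C\<in>UNIV. \<Sum>A\<in>UNIV. \<Sum>B\<in>UNIV.
        wedge_const A B E * wedge_const E C D * ext_coeff x A * ext_coeff y B * ext_coeff z C)"
      by (simp add: times_exterior_def sum_distrib_left sum_distrib_right mult_ac)
    also have "\<dots> = (\<Sum>C\<in>UNIV. \<Sum>E\<in>UNIV. \<Sum>A\<in>UNIV. \<Sum>B\<in>UNIV.
        wedge_const A B E * wedge_const E C D * ext_coeff x A * ext_coeff y B * ext_coeff z C)"
      by (rule sum.swap)
    also have "\<dots> = (\<Sum>C\<in>UNIV. \<Sum>A\<in>UNIV. \<Sum>E\<in>UNIV. \<Sum>B\<in>UNIV.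
        wedge_const A B E * wedge_const E C D * ext_coeff x A * ext_coeff y B * ext_coeff z C)"
      by (intro sum.cong refl sum.swap)
    also have "\<dots> = (\<Sum>C\<in>UNIV. \<Sum>A\<in>UNIV. \<Sum>B\<in>UNIV. \<Sum>E\<in>UNIV.
        wedge_const A B E * wedge_const E C D * ext_coeff x A * ext_coeff y B * ext_coeff z C)"
      by (intro sum.cong refl sum.swap)
    also have "\<dots> = (\<Sum>C\<in>UNIV. \<Sum>A\<in>UNIV. \<Sum>B\<in>UNIV.
        (\<Sum>E\<in>UNIV. wedge_const A B E * wedge_const E C D) * ext_coeff x A * ext_coeff y B * ext_coeff z C)"
      by (simp add: sum_distrib_right)
    also have "\<dots> = (\<Sum>C\<in>UNIV. \<Sum>A\<in>UNIV. \<Sum>B\<in>UNIV. \<Sum>E\<in>UNIV.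
        wedge_const A E D * wedge_const B C E * ext_coeff x A * ext_coeff y B * ext_coeff z C)"
      by (simp add: sum_distrib_right wedge_const_assoc)
    also have "\<dots> = (\<Sum>A\<in>UNIV. \<Sum>C\<in>UNIV. \<Sum>B\<in>UNIV. \<Sum>E\<in>UNIV.
        wedge_const A E D * wedge_const B C E * ext_coeff x A * ext_coeff y B * ext_coeff z C)"
      by (rule sum.swap)
    also have "\<dots> = (\<Sum>A\<in>UNIV. \<Sum>B\<in>UNIV. \<Sum>C\<in>UNIV. \<Sum>E\<in>UNIV.
        wedge_const A E D * wedge_const B C E * ext_coeff x A * ext_coeff y B * ext_coeff z C)"
      by (intro sum.cong refl sum.swap)
    also have "\<dots> = (\<Sum>A\<in>UNIV. \<Sum>B\<in>UNIV. \<Sum>E\<in>UNIV. \<Sum>C\<in>UNIV.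
        wedge_const A E D * wedge_const B C E * ext_coeff x A * ext_coeff y B * ext_coeff z C)"
      by (intro sum.cong refl sum.swap)
    also have "\<dots> = (\<Sum>A\<in>UNIV. \<Sum>E\<in>UNIV. \<Sum>B\<in>UNIV. \<Sum>C\<in>UNIV.
        wedge_const A E D * wedge_const B C E * ext_coeff x A * ext_coeff y B * ext_coeff z C)"
      by (intro sum.cong refl sum.swap)
    also have "\<dots> = ext_coeff (x * (y * z)) D"
      by (simp add: times_exterior_def sum_distrib_left sum_distrib_right mult_ac)
    finally show "ext_coeff (x * y * z) D = ext_coeff (x * (y * z)) D" .
  qed
  show "(x + y) * z = x * z + y * z" "x * (y + z) = x * y + x * z"
    by (rule exterior_eqI; simp add: times_exterior_def algebra_simps sum.distrib)+
  show "c *\<^sub>R x * y = c *\<^sub>R (x * y)" "x * c *\<^sub>R y = c *\<^sub>R (x * y)"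
    by (rule exterior_eqI; simp add: times_exterior_def sum_distrib_left mult_ac)+
  have l: "wedge_const {} B C = (if B = C then 1 else 0)" for B C :: "'a set"
    by (simp add: wedge_const_def)
  have r: "wedge_const A {} C = (if A = C then 1 else 0)" for A C :: "'a set"
    by (simp add: wedge_const_def)
  have d: "(\<Sum>A\<in>UNIV. \<Sum>B\<in>UNIV. (if A = {} then p A B else 0)) = (\<Sum>B\<in>UNIV. p {} B)"
    for p :: "'a set \<Rightarrow> 'a set \<Rightarrow> real"
    by (subst sum.swap) (simp add: sum.delta)
  show "1 * x = x"
  proof (rule exterior_eqI)
    fix C
    have "ext_coeff (1 * x) C = (\<Sum>A\<in>UNIV. \<Sum>B\<in>UNIV. (if A = {} then wedge_const A B C * ext_coeff x B else 0))"
      unfolding times_exterior_def one_exterior_def ext_coeff_Ext by (intro sum.cong refl) simp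
    also have "\<dots> = (\<Sum>B\<in>UNIV. if C = B then ext_coeff x B else 0)"
      unfolding d l by (intro sum.cong refl) auto
    finally show "ext_coeff (1 * x) C = ext_coeff x C" by simp
  qed
  show "x * 1 = x"
  proof (rule exterior_eqI)
    fix C
    have "ext_coeff (x * 1) C = (\<Sum>A\<in>UNIV. \<Sum>B\<in>UNIV. (if B = {} then wedge_const A B C * ext_coeff x A else 0))"
      unfolding times_exterior_def one_exterior_def ext_coeff_Ext by (intro sum.cong refl) simp
    also have "\<dots> = (\<Sum>A\<in>UNIV. if C = A then ext_coeff x A else 0)"
      by (intro sum.cong refl) (simp add: r)
    finally show "ext_coeff (x * 1) C = ext_coeff x C" by simp
  qed
  show "(0::'a exterior) \<noteq> 1"
  proof
    assume "(0::'a exterior) = 1"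
    then have "ext_coeff (0::'a exterior) {} = ext_coeff 1 {}" by simp
    then show False by (simp add: one_exterior_def)
  qed
qed
end

instantiation exterior :: ("{finite,linorder}") real_normed_algebra_1
begin
definition "norm x = (\<Sum>A\<in>UNIV. \<bar>ext_coeff x A\<bar>)"
definition "dist x y = norm (x - y)" for x y :: "'a exterior"
definition "sgn x = x /\<^sub>R norm x" for x :: "'a exterior"
definition "(uniformity :: ('a exterior \<times> 'a exterior) filter) =
  (INF e\<in>{0<..}. principal {(x, y). dist x y < e})"
definition "open (U :: 'a exterior set) \<longleftrightarrow> (\<forall>x\<in>U. \<forall>\<^sub>F (x', y) in uniformity. x' = x \<longrightarrow> y \<in> U)"

instance
proof
  fix x y :: "'a exterior" and c :: real and U :: "'a exterior set"
  show "dist x y = norm (x - y)" by (rule dist_exterior_def)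
  show "sgn x = x /\<^sub>R norm x" by (rule sgn_exterior_def)
  show "(uniformity :: ('a exterior \<times> 'a exterior) filter) =
    (INF e\<in>{0<..}. principal {(x, y). dist x y < e})" by (rule uniformity_exterior_def)
  show "open U \<longleftrightarrow> (\<forall>x\<in>U. \<forall>\<^sub>F (x', y) in uniformity. x' = x \<longrightarrow> y \<in> U)"
    by (rule open_exterior_def)
  show "norm x = 0 \<longleftrightarrow> x = 0"
    by (auto simp: norm_exterior_def sum_nonneg_eq_0_iff intro: exterior_eqI)
  show "norm (x + y) \<le> norm x + norm y"
    by (auto simp: norm_exterior_def sum.distrib[symmetric] intro: sum_mono)
  show "norm (c *\<^sub>R x) = \<bar>c\<bar> * norm x"
    by (simp add: norm_exterior_def abs_mult sum_distrib_left)
  show "norm (1::'a exterior) = 1"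
    by (simp add: norm_exterior_def one_exterior_def if_distrib cong: if_cong)
  show "norm (x * y) \<le> norm x * norm y"
  proof -
    have "norm (x * y) \<le> (\<Sum>C\<in>UNIV. \<Sum>A\<in>UNIV. \<Sum>B\<in>UNIV. \<bar>wedge_const A B C\<bar> * \<bar>ext_coeff x A\<bar> * \<bar>ext_coeff y B\<bar>)"
      unfolding norm_exterior_def times_exterior_def ext_coeff_Ext
      by (intro sum_mono order.trans[OF sum_abs]) (simp add: abs_mult)
    also have "\<dots> = (\<Sum>A\<in>UNIV. \<Sum>C\<in>UNIV. \<Sum>B\<in>UNIV. \<bar>wedge_const A B C\<bar> * \<bar>ext_coeff x A\<bar> * \<bar>ext_coeff y B\<bar>)"
      by (rule sum.swap)
    also have "\<dots> = (\<Sum>A\<in>UNIV. \<Sum>B\<in>UNIV. \<Sum>C\<in>UNIV. \<bar>wedge_const A B C\<bar> * \<bar>ext_coeff x A\<bar> * \<bar>ext_coeff y B\<bar>)"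
      by (intro sum.cong refl sum.swap)
    also have "\<dots> = (\<Sum>A\<in>UNIV. \<Sum>B\<in>UNIV. (\<Sum>C\<in>UNIV. \<bar>wedge_const A B C\<bar>) * (\<bar>ext_coeff x A\<bar> * \<bar>ext_coeff y B\<bar>))"
      by (simp add: sum_distrib_right mult.assoc)
    also have "\<dots> \<le> (\<Sum>A\<in>UNIV. \<Sum>B\<in>UNIV. 1 * (\<bar>ext_coeff x A\<bar> * \<bar>ext_coeff y B\<bar>))"
      by (intro sum_mono mult_right_mono wedge_const_abs_sum) auto
    also have "\<dots> = norm x * norm y"
      by (simp add: norm_exterior_def sum_product)
    finally show ?thesis .
  qed
qed
end

lemma abs_ext_coeff_le_norm: "\<bar>ext_coeff x A\<bar> \<le> norm (x :: 'n::{finite,linorder} exterior)"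
  unfolding norm_exterior_def by (rule member_le_sum) auto

instance exterior :: ("{finite,linorder}") banach
proof
  fix x :: "nat \<Rightarrow> 'a exterior"
  assume x: "Cauchy x"
  have "Cauchy (\<lambda>n. ext_coeff (x n) A)" for A
  proof (rule CauchyI)
    fix e :: real assume "0 < e"
    then obtain M where M: "\<forall>m\<ge>M. \<forall>n\<ge>M. norm (x m - x n) < e" using CauchyD[OF x] by blast
    have "norm (ext_coeff (x m) A - ext_coeff (x n) A) < e" if "m \<ge> M" "n \<ge> M" for m n
    proof -
      have "norm (ext_coeff (x m) A - ext_coeff (x n) A) \<le> norm (x m - x n)"
        using abs_ext_coeff_le_norm[of "x m - x n" A] by simp
      also have "\<dots> < e" using M that by blast
      finally show ?thesis .
    qed
    then show "\<exists>M. \<forall>m\<ge>M. \<forall>n\<ge>M. norm (ext_coeff (x m) A - ext_coeff (x n) A) < e" by blast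
  qed
  then have "\<forall>A. \<exists>l. (\<lambda>n. ext_coeff (x n) A) \<longlonglongrightarrow> l"
    using Cauchy_convergent_iff convergent_def by blast
  then obtain l where l: "\<And>A. (\<lambda>n. ext_coeff (x n) A) \<longlonglongrightarrow> l A" by metis
  have "(\<lambda>n. \<Sum>A\<in>UNIV. \<bar>ext_coeff (x n) A - l A\<bar>) \<longlonglongrightarrow> (\<Sum>A\<in>(UNIV :: 'a set set). \<bar>l A - l A\<bar>)"
    by (intro tendsto_intros l)
  then have "(\<lambda>n. norm (x n - Ext l)) \<longlonglongrightarrow> 0"
    by (simp add: norm_exterior_def)
  then have "x \<longlonglongrightarrow> Ext l"
    by (simp add: LIM_zero_iff tendsto_norm_zero_iff)
  then show "convergent x" by (rule convergentI)
qed

definition ext_gen :: "'n::{finite,linorder} \<Rightarrow> 'n exterior" where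
  "ext_gen i = Ext (\<lambda>A. if A = {i} then 1 else 0)"

definition degree_part :: "nat \<Rightarrow> 'n exterior \<Rightarrow> 'n exterior" where
  "degree_part d w = Ext (\<lambda>A. if card A = d then ext_coeff w A else 0)"

text \<open>Integration of a path of forms over the parameter interval \<open>[0, 1]\<close>, coefficient by coefficient.\<close>

definition integral01 :: "(real \<Rightarrow> 'n exterior) \<Rightarrow> 'n exterior" where
  "integral01 w = Ext (\<lambda>A. integral {0..1} (\<lambda>t. ext_coeff (w t) A))"

section \<open>Differential forms in a frame\<close>

text \<open>\<open>E\<close> is a family of vector fields forming a basis of the tangent space at \<open>x\<close>. The algebra of
  forms at \<open>x\<close> is the exterior algebra on the dual basis, and endomorphism-valued forms at \<open>x\<close> are
  matrices over it.\<close>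

definition lin_comb :: "('n::finite \<Rightarrow> 'a vfield) \<Rightarrow> 'a \<Rightarrow> real^'n \<Rightarrow> 'a tangent_vector" where
  "lin_comb E x u = (\<lambda>h. \<Sum>i\<in>UNIV. u $ i * E i x h)"

definition frame_at ::
  "('a::topological_space, 'e::euclidean_space) chart set \<Rightarrow> 'a \<Rightarrow> ('n::finite \<Rightarrow> 'a vfield) \<Rightarrow> bool" where
  "frame_at \<A> x E \<longleftrightarrow> (\<forall>i. E i \<in> vfields \<A>) \<and>
     (\<forall>v\<in>tangent_space \<A> UNIV x. \<exists>!u. v = lin_comb E x u)"

definition coords :: "('n::finite \<Rightarrow> 'a vfield) \<Rightarrow> 'a \<Rightarrow> 'a tangent_vector \<Rightarrow> real^'n" where
  "coords E x v = (THE u. v = lin_comb E x u)"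

definition endo_matrix :: "('n::finite \<Rightarrow> 'a vfield) \<Rightarrow> 'a \<Rightarrow> ('a vfield \<Rightarrow> 'a vfield) \<Rightarrow> real^'n^'n" where
  "endo_matrix E x S = (\<chi> i j. coords E x (S (E j) x) $ i)"

type_synonym 'n form_matrix = "(('n exterior, 'n) vec, 'n) vec"

definition endo_form0 ::
  "('n::{finite,linorder} \<Rightarrow> 'a vfield) \<Rightarrow> 'a \<Rightarrow> ('a vfield \<Rightarrow> 'a vfield) \<Rightarrow> 'n form_matrix" where
  "endo_form0 E x S = (\<chi> i j. of_real (endo_matrix E x S $ i $ j))"

definition endo_form1 ::
  "('n::{finite,linorder} \<Rightarrow> 'a vfield) \<Rightarrow> 'a \<Rightarrow> ('a vfield \<Rightarrow> 'a vfield \<Rightarrow> 'a vfield) \<Rightarrow>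
   'n form_matrix" where
  "endo_form1 E x S = (\<chi> i j. \<Sum>a\<in>UNIV. (endo_matrix E x (S (E a)) $ i $ j) *\<^sub>R ext_gen a)"

definition endo_form2 ::
  "('n::{finite,linorder} \<Rightarrow> 'a vfield) \<Rightarrow> 'a \<Rightarrow> ('a vfield \<Rightarrow> 'a vfield \<Rightarrow> 'a vfield \<Rightarrow> 'a vfield) \<Rightarrow>
   'n form_matrix" where
  "endo_form2 E x S = (\<chi> i j. \<Sum>a\<in>UNIV. \<Sum>b\<in>{a<..}.
     (endo_matrix E x (S (E a) (E b)) $ i $ j) *\<^sub>R (ext_gen a * ext_gen b))"

section \<open>Power series of matrices\<close>

text \<open>The instance of \<open>times\<close> on vectors is componentwise, so powers have to be taken
  with respect to \<open>**\<close> explicitly.\<close>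

primrec mat_power :: "'a::semiring_1^'n^'n \<Rightarrow> nat \<Rightarrow> 'a^'n^'n" where
  "mat_power A 0 = mat 1"
| "mat_power A (Suc n) = A ** mat_power A n"

definition taylor_coeff :: "(real \<Rightarrow> real) \<Rightarrow> nat \<Rightarrow> real" where
  "taylor_coeff p n = (deriv ^^ n) p 0 / fact n"

definition mat_fun :: "(real \<Rightarrow> real) \<Rightarrow> 'a::real_normed_algebra_1^'n^'n \<Rightarrow> 'a^'n^'n" where
  "mat_fun p A = (\<Sum>n. taylor_coeff p n *\<^sub>R mat_power A n)"

definition H_poly :: "nat \<Rightarrow> 'a::semiring_1^'n^'n \<Rightarrow> 'a^'n^'n \<Rightarrow> 'a^'n^'n" where
  "H_poly n a b = (\<Sum>q<n. mat_power a q ** b ** mat_power a (n - 1 - q))"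

definition second_quot :: "(real \<Rightarrow> real) \<Rightarrow> 'a::real_normed_algebra_1^'n^'n \<Rightarrow> 'a^'n^'n \<Rightarrow> 'a^'n^'n" where
  "second_quot p a b = (\<Sum>n. ((deriv ^^ (n + 1)) p 0 / fact n) *\<^sub>R H_poly n a b)"

section \<open>The transgression form of the L-form\<close>

definition L_ftilde :: "real \<Rightarrow> real" where
  "L_ftilde x = (if x = 0 then 1 else (x / 2) / tanh (x / 2))"

definition L_f :: "real \<Rightarrow> real" where
  "L_f x = ln (L_ftilde x) / 2"

definition nabla_form ::
  "('n::{finite,linorder} \<Rightarrow> 'a vfield) \<Rightarrow> 'a \<Rightarrow> 'a connection \<Rightarrow> 'a vfield \<Rightarrow> 'n form_matrix" where
  "nabla_form E x D X = endo_form0 E x (\<lambda>Y. D Y X)"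

definition curvature_form ::
  "('n::{finite,linorder} \<Rightarrow> 'a vfield) \<Rightarrow> 'a \<Rightarrow> 'a connection \<Rightarrow> 'n form_matrix" where
  "curvature_form E x D = endo_form2 E x (curvature D)"

definition equivariant_curvature ::
  "('n::{finite,linorder} \<Rightarrow> 'a vfield) \<Rightarrow> 'a \<Rightarrow> 'a connection \<Rightarrow> 'a vfield \<Rightarrow> 'n form_matrix" where
  "equivariant_curvature E x D X = curvature_form E x D - nabla_form E x D X"

text \<open>The value at \<open>x\<close>, expressed in the frame \<open>E\<close>, of the transgression form; \<open>D1\<close> and \<open>D0\<close> are
  the Levi-Civita connections of the two metrics. The exponential factor is
  \<open>L\<close>, the square root of \<open>det\<close> of \<open>L_ftilde\<close> applied to the equivariant curvature.\<close>

definition TL ::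
  "('n::{finite,linorder} \<Rightarrow> 'a vfield) \<Rightarrow> 'a \<Rightarrow> 'a connection \<Rightarrow> 'a connection \<Rightarrow> 'a vfield \<Rightarrow> 'n exterior" where
  "TL E x D1 D0 X = integral01 (\<lambda>t.
     exp (trace (mat_fun L_f (equivariant_curvature E x (conn_path D1 D0 t) X))) *
     trace (endo_form1 E x (conn_diff D1 D0) **
            mat_fun (deriv L_f) (equivariant_curvature E x (conn_path D1 D0 t) X)))"

text \<open>Smallness of \<open>X\<close>: all endomorphisms \<open>\<nabla>\<^sup>tX\<close> have operator norm, with respect to \<open>g\<close>, bounded by
  some \<open>r\<close> less than the radius of convergence of the Taylor series of \<open>f\<close>.\<close>

definition small_for_convergence ::
  "('a::topological_space, real^'n::finite) chart set \<Rightarrow> 'a metric_tensor \<Rightarrow> 'a connection \<Rightarrow> 'a connection \<Rightarrow>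
   'a vfield \<Rightarrow> bool" where
  "small_for_convergence \<A> g D1 D0 X \<longleftrightarrow>
     (\<exists>r. ereal r < conv_radius (taylor_coeff L_f) \<and>
       (\<forall>x. \<forall>E :: 'n::finite \<Rightarrow> 'a vfield. frame_at \<A> x E \<longrightarrow> (\<forall>t\<in>{0..1}. \<forall>u.
          let v = lin_comb E x u; w = lin_comb E x (endo_matrix E x (\<lambda>Y. conn_path D1 D0 t Y X) *v u)
          in sqrt (g x w w) \<le> r * sqrt (g x v v))))"

end

theory Submission
  imports Defs "HOL-Complex_Analysis.Complex_Analysis"
begin

text \<open>
  The formula holds pointwise in the parameter \<open>t\<close>, before integration, and is an identity about three
  matrices over the exterior algebra: the scalar matrix \<open>A\<close> of \<open>\<nabla>\<^sup>tX\<close>, the matrix \<open>R\<close> of curvature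
  2-forms and the matrix \<open>\<Theta>\<close> of 1-forms. In a power series at \<open>R - A\<close> the number of factors \<open>R\<close> is half
  the form degree, so degree 0 of \<open>p(R - A)\<close> is \<open>p(-A)\<close>, and degree 2 is the part linear in \<open>R\<close>, the
  series of the polynomials \<open>H_n(-A, R)\<close> (\<open>mat_fun_graded\<close>).

  Under the trace the scalar powers of \<open>A\<close> can be rotated. This gives
  \<open>Tr f(R - A)\<^sub>[\<^sub>2\<^sub>] = Tr (f'(-A) R)\<close> and turns \<open>Tr (\<Theta> H_n(A, R))\<close> into \<open>Tr (H_n(A, \<Theta>) R)\<close>, which is the term
  of \<open>f\<^sup>[\<^sup>2\<^sup>](A) * \<Theta>\<close> paired with \<open>R\<close>. The exponential contributes its parts of degree 0 and 2
  only, because \<open>\<Theta>\<close> uses up one degree. The evenness of \<open>f\<close> (\<open>taylor_coeff_L_f_odd\<close>) removes the signs of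
  \<open>-A\<close>. All this is put together in \<open>degree_3_transgression_integrand\<close>.

  What remains is convergence of the power series in every form degree. The smallness of \<open>X\<close> bounds the
  powers of \<open>A\<close> by \<open>C r\<^sup>n\<close> with \<open>r\<close> below the radius of convergence
  (\<open>matrix_powers_bounded_by_metric\<close>), and the forms of positive degree can be made arbitrarily small by an
  automorphism of the exterior algebra
  (\<open>summable_power_series_nilpotent_perturbation\<close>).
\<close>

section \<open>Matrices over a normed algebra\<close>

lemma norm_matrix_mult_le:
  fixes M :: "'a::real_normed_algebra_1^'n^'m" and N :: "'a^'p^'n"
  shows "norm (M ** N) \<le> norm M * norm N"
proof -
  have scaled: "norm (\<chi> j. a * y $ j) \<le> norm a * norm y" for a :: 'a and y :: "'a^'p"
    unfolding norm_vec_def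
    by (subst L2_set_right_distrib) (auto intro!: L2_set_mono norm_mult_ineq)
  have row: "norm ((M ** N) $ i) \<le> norm (M $ i) * norm N" for i
  proof -
    have "(M ** N) $ i = (\<Sum>k\<in>UNIV. \<chi> j. M $ i $ k * N $ k $ j)"
      by (simp add: vec_eq_iff matrix_matrix_mult_def)
    then have "norm ((M ** N) $ i) \<le> (\<Sum>k\<in>UNIV. norm (\<chi> j. M $ i $ k * N $ k $ j))"
      by (simp add: norm_sum)
    also have "\<dots> \<le> (\<Sum>k\<in>UNIV. \<bar>norm (M $ i $ k)\<bar> * \<bar>norm (N $ k)\<bar>)"
      by (rule sum_mono) (use scaled in simp)
    also have "\<dots> \<le> norm (M $ i) * norm N"
      unfolding norm_vec_def[of "M $ i"] norm_vec_def[of N] by (rule L2_set_mult_ineq)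
    finally show ?thesis .
  qed
  have "norm (M ** N) \<le> L2_set (\<lambda>i. norm (M $ i) * norm N) UNIV"
    unfolding norm_vec_def[of "M ** N"] by (rule L2_set_mono) (auto simp: row)
  also have "\<dots> = norm M * norm N"
    unfolding norm_vec_def[of M] by (subst L2_set_left_distrib) auto
  finally show ?thesis .
qed

interpretation matrix_mult: bounded_bilinear
  "(**) :: 'a::real_normed_algebra_1^'n^'m \<Rightarrow> 'a^'p^'n \<Rightarrow> 'a^'p^'m"
proof (rule bounded_bilinear.intro)
  show "\<exists>K. \<forall>(M :: 'a^'n^'m) (N :: 'a^'p^'n). norm (M ** N) \<le> norm M * norm N * K"
    using norm_matrix_mult_le by (intro exI[of _ 1]) auto
qed (simp_all add: vec_eq_iff matrix_matrix_mult_def algebra_simps sum.distrib scaleR_sum_right)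

lemma bounded_linear_trace: "bounded_linear (trace :: 'a::real_normed_algebra_1^'n^'n \<Rightarrow> 'a)"
  unfolding trace_def
  by (intro bounded_linear_sum bounded_linear_compose[OF bounded_linear_vec_nth] bounded_linear_vec_nth)

lemma H_poly_0 [simp]: "H_poly 0 a b = 0"
  by (simp add: H_poly_def)

text \<open>\<open>H_n(a, b)\<close> is the part of \<open>(a + b)\<^sup>n\<close> linear in \<open>b\<close>; this is the Leibniz rule for
  \<open>(a + b) (a + b)\<^sup>n\<close>.\<close>

lemma H_poly_Suc:
  fixes a b :: "'a::real_normed_algebra_1^'n^'n"
  shows "H_poly (Suc n) a b = a ** H_poly n a b + b ** mat_power a n"
proof -
  have "H_poly (Suc n) a b = b ** mat_power a n +
      (\<Sum>q<n. a ** mat_power a q ** b ** mat_power a (n - Suc q))"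
    unfolding H_poly_def sum.lessThan_Suc_shift by simp
  also have "(\<Sum>q<n. a ** mat_power a q ** b ** mat_power a (n - Suc q)) = a ** H_poly n a b"
    by (simp add: H_poly_def matrix_mult.sum_right matrix_mul_assoc)
  finally show ?thesis by simp
qed

text \<open>Expanding \<open>(A + N)\<^sup>n\<close> into words and using only the power bound on the blocks of \<open>A\<close>
  between consecutive factors \<open>N\<close> suggests the bound \<open>C (r + C |N|)\<^sup>n\<close>. The factor \<open>A\<^sup>m\<close> on the
  left records the block being read, so that a plain induction on \<open>n\<close> replaces the expansion.\<close>

lemma mat_power_perturbed_bound:
  fixes A N :: "'a::real_normed_algebra_1^'n^'n"
  assumes A: "\<And>m. norm (mat_power A m) \<le> C * r ^ m" and r: "0 \<le> r"
  shows "norm (mat_power A m ** mat_power (A + N) n) \<le> C * r ^ m * (r + C * norm N) ^ n"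
proof (induction n arbitrary: m)
  case 0
  then show ?case using A by simp
next
  case (Suc n)
  let ?B = "mat_power (A + N) n"
  have C: "0 \<le> C" using order.trans[OF norm_ge_zero A[of 0]] by simp
  have comm: "mat_power A m ** A = A ** mat_power A m" for m
    by (induction m) (simp_all add: matrix_mul_assoc[symmetric])
  have "mat_power A m ** mat_power (A + N) (Suc n) =
      mat_power A (Suc m) ** ?B + mat_power A m ** (N ** ?B)"
    by (simp add: matrix_mult.add_left matrix_mult.add_right matrix_mul_assoc comm)
  then have "norm (mat_power A m ** mat_power (A + N) (Suc n)) \<le>
      norm (mat_power A (Suc m) ** ?B) + norm (mat_power A m ** (N ** ?B))"
    by (simp add: norm_triangle_ineq)
  also have "\<dots> \<le> C * r ^ Suc m * (r + C * norm N) ^ n +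
      C * r ^ m * (norm N * (C * (r + C * norm N) ^ n))"
  proof (rule add_mono)
    have "norm (mat_power A m ** (N ** ?B)) \<le> norm (mat_power A m) * (norm N * norm ?B)"
      by (meson norm_matrix_mult_le mult_left_mono norm_ge_zero order.trans)
    also have "\<dots> \<le> C * r ^ m * (norm N * (C * (r + C * norm N) ^ n))"
      using Suc.IH[of 0] C r by (intro mult_mono A) auto
    finally show "norm (mat_power A m ** (N ** ?B)) \<le> \<dots>" .
  qed (rule Suc.IH)
  also have "\<dots> = C * r ^ m * (r + C * norm N) ^ Suc n"
    by (simp add: algebra_simps)
  finally show ?case .
qed

lemma norm_matrix_mono:
  fixes M :: "'a::real_normed_vector^'n^'m" and N :: "'b::real_normed_vector^'n^'m"
  assumes "\<And>i j. norm (M $ i $ j) \<le> c * norm (N $ i $ j)" and "0 \<le> c"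
  shows "norm M \<le> c * norm N"
  unfolding norm_vec_def using assms
  by (simp add: L2_set_right_distrib) (intro L2_set_mono, auto intro!: L2_set_mono simp: L2_set_right_distrib)

text \<open>Over the exterior algebra the trace is not cyclic in general, but a factor with central
  entries can still be moved around.\<close>

lemma trace_mult_commute_central:
  fixes P M :: "'a::real_normed_algebra_1^'n^'n"
  assumes "\<And>i j y. P $ i $ j * y = y * P $ i $ j"
  shows "trace (P ** M) = trace (M ** P)"
  unfolding trace_def matrix_matrix_mult_def
  by (simp add: assms) (rule sum.swap)

section \<open>The grading of the exterior algebra\<close>

lemma degree_part_simps [simp]:
  "ext_coeff (degree_part d x) A = (if card A = d then ext_coeff x A else 0)"
  by (simp add: degree_part_def)

lemma ext_coeff_sum [simp]: "ext_coeff (\<Sum>i\<in>I. f i) A = (\<Sum>i\<in>I. ext_coeff (f i) A)"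
  by (induction I rule: infinite_finite_induct) auto

lemma norm_degree_part_le: "norm (degree_part d x) \<le> norm (x :: 'n::{finite,linorder} exterior)"
  unfolding norm_exterior_def by (auto intro!: sum_mono)

lemma bounded_linear_degree_part: "bounded_linear (degree_part d :: 'n::{finite,linorder} exterior \<Rightarrow> _)"
  by (rule bounded_linear_intro[where K = 1]) (auto intro!: exterior_eqI simp: norm_degree_part_le)

lemma degree_part_idem [simp]:
  "degree_part d (degree_part e x) = (if d = e then degree_part d x else 0)"
  by (auto intro!: exterior_eqI)

lemma wedge_const_card: "wedge_const A B C \<noteq> 0 \<Longrightarrow> card C = card A + card B"
  by (auto simp: wedge_const_def card_Un_disjoint split: if_splits)

text \<open>The exterior algebra is graded: \<open>e\<^sub>A e\<^sub>B\<close> is a multiple of \<open>e\<close> at \<open>A \<union> B\<close> with \<open>A\<close> and \<open>B\<close>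
  disjoint, so degrees add.\<close>

lemma degree_part_mult:
  fixes x y :: "'n::{finite,linorder} exterior"
  shows "degree_part d (x * y) = (\<Sum>i\<le>d. degree_part i x * degree_part (d - i) y)"
proof (rule exterior_eqI)
  fix C
  have "ext_coeff (\<Sum>i\<le>d. degree_part i x * degree_part (d - i) y) C = (\<Sum>i\<le>d. \<Sum>A\<in>UNIV. \<Sum>B\<in>UNIV.
      wedge_const A B C * ext_coeff (degree_part i x) A * ext_coeff (degree_part (d - i) y) B)"
    by (simp only: ext_coeff_sum times_exterior_def ext_coeff_Ext)
  also have "\<dots> = (\<Sum>A\<in>UNIV. \<Sum>B\<in>UNIV. \<Sum>i\<le>d.
      wedge_const A B C * ext_coeff (degree_part i x) A * ext_coeff (degree_part (d - i) y) B)"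
    by (subst sum.swap) (intro sum.cong refl sum.swap)
  also have "\<dots> = (\<Sum>A\<in>UNIV. \<Sum>B\<in>UNIV. if card C = d then
      wedge_const A B C * ext_coeff x A * ext_coeff y B else 0)"
  proof (intro sum.cong refl)
    fix A B
    show "(\<Sum>i\<le>d. wedge_const A B C * ext_coeff (degree_part i x) A * ext_coeff (degree_part (d - i) y) B)
      = (if card C = d then wedge_const A B C * ext_coeff x A * ext_coeff y B else 0)"
    proof (cases "wedge_const A B C = 0")
      case False
      then have card: "card C = card A + card B" by (rule wedge_const_card)
      have "(\<Sum>i\<le>d. wedge_const A B C * ext_coeff (degree_part i x) A * ext_coeff (degree_part (d - i) y) B)
        = (\<Sum>i\<le>d. if i = card A then (if card C = d then
            wedge_const A B C * ext_coeff x A * ext_coeff y B else 0) else 0)"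
        by (intro sum.cong refl) (auto simp: card)
      then show ?thesis by (auto simp: card)
    qed auto
  qed
  also have "\<dots> = ext_coeff (degree_part d (x * y)) C"
    by (simp add: times_exterior_def)
  finally show "ext_coeff (degree_part d (x * y)) C =
    ext_coeff (\<Sum>i\<le>d. degree_part i x * degree_part (d - i) y) C" by simp
qed

text \<open>Exchanging \<open>e\<^sub>A\<close> and \<open>e\<^sub>B\<close> turns inversions into non-inversions among the \<open>|A| |B|\<close> pairs, so
  the sign changes by \<open>(-1)\<close> to the power \<open>|A| |B|\<close>, which is 1 if \<open>|A|\<close> is even.\<close>

lemma even_degree_commutes:
  fixes x y :: "'n::{finite,linorder} exterior"
  assumes "even d"
  shows "degree_part d x * y = y * degree_part d x"
proof (rule exterior_eqI)
  fix C
  have swap: "wedge_const A B C = wedge_const B A C" if "even (card A)" for A B :: "'n set"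
  proof (cases "A \<inter> B = {}")
    case True
    let ?I = "{(a, b). a \<in> A \<and> b \<in> B \<and> b < a}" and ?J = "{(a, b). a \<in> A \<and> b \<in> B \<and> a < b}"
    have "{(b, a). b \<in> B \<and> a \<in> A \<and> a < b} = prod.swap ` ?J" by auto
    then have J: "card {(b, a). b \<in> B \<and> a \<in> A \<and> a < b} = card ?J"
      by (simp add: card_image)
    have "?I \<union> ?J = A \<times> B" using True by auto
    moreover have "card (?I \<union> ?J) = card ?I + card ?J"
      by (rule card_Un_disjoint) auto
    ultimately have "card ?I + card ?J = card A * card B"
      by (simp add: card_cartesian_product)
    then have "even (card ?I + card ?J)" using that by simp
    then have "(-1::real) ^ card ?I = (-1) ^ card ?J" by (simp add: minus_one_power_iff)
    then show ?thesis using True J by (auto simp: wedge_const_def Int_commute Un_commute)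
  qed (auto simp: wedge_const_def)
  have "ext_coeff (degree_part d x * y) C =
      (\<Sum>A\<in>UNIV. \<Sum>B\<in>UNIV. wedge_const B A C * ext_coeff y B * ext_coeff (degree_part d x) A)"
    unfolding times_exterior_def ext_coeff_Ext
  proof (intro sum.cong refl)
    fix A B
    show "wedge_const A B C * ext_coeff (degree_part d x) A * ext_coeff y B =
      wedge_const B A C * ext_coeff y B * ext_coeff (degree_part d x) A"
      using swap[of A B] assms by (cases "card A = d") auto
  qed
  also have "\<dots> = ext_coeff (y * degree_part d x) C"
    unfolding times_exterior_def ext_coeff_Ext by (rule sum.swap)
  finally show "ext_coeff (degree_part d x * y) C = ext_coeff (y * degree_part d x) C" .
qed

lemma degree_part_of_real [simp]: "degree_part d (of_real a) = (if d = 0 then of_real a else 0)"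
  by (rule exterior_eqI) (auto simp: of_real_def one_exterior_def)

lemma degree_part_0_eq: "degree_part 0 x = of_real (ext_coeff x {})"
  by (rule exterior_eqI) (auto simp: of_real_def one_exterior_def)

lemma degree_part_ext_gen [simp]: "degree_part d (ext_gen a) = (if d = 1 then ext_gen a else 0)"
  by (rule exterior_eqI) (auto simp: ext_gen_def)

text \<open>Because degrees add under multiplication, scaling the degree \<open>d\<close> part by \<open>s\<^sup>d\<close>, \<open>s \<noteq> 0\<close>, is an algebra
  automorphism. For small \<open>s\<close> it shrinks everything of positive degree while fixing the scalars, at
  the price of a constant factor in norm comparisons.\<close>

definition grade_scale :: "real \<Rightarrow> 'n exterior \<Rightarrow> 'n exterior" where
  "grade_scale s x = Ext (\<lambda>A. s ^ card A * ext_coeff x A)"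

lemma grade_scale_mult:
  fixes x y :: "'n::{finite,linorder} exterior"
  shows "grade_scale s (x * y) = grade_scale s x * grade_scale s y"
proof (rule exterior_eqI)
  fix C
  have "s ^ card C * (wedge_const A B C * ext_coeff x A * ext_coeff y B) =
    wedge_const A B C * (s ^ card A * ext_coeff x A) * (s ^ card B * ext_coeff y B)" for A B
    by (cases "wedge_const A B C = 0") (auto simp: wedge_const_card power_add)
  then show "ext_coeff (grade_scale s (x * y)) C = ext_coeff (grade_scale s x * grade_scale s y) C"
    by (simp only: grade_scale_def times_exterior_def sum_distrib_left ext_coeff_Ext)
qed

lemma grade_scale_sum: "grade_scale s (\<Sum>i\<in>I. f i) = (\<Sum>i\<in>I. grade_scale s (f i))"
  by (rule exterior_eqI) (simp add: grade_scale_def sum_distrib_left)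

lemma grade_scale_add: "grade_scale s (x + y) = grade_scale s x + grade_scale s y"
  by (rule exterior_eqI) (simp add: grade_scale_def distrib_left)

lemma grade_scale_of_real [simp]: "grade_scale s (of_real a) = of_real a"
  by (rule exterior_eqI) (auto simp: grade_scale_def of_real_def one_exterior_def)

lemma norm_grade_scale_ge:
  fixes x :: "'n::{finite,linorder} exterior"
  assumes "0 < s" "s \<le> 1"
  shows "norm x \<le> (1 / s) ^ CARD('n) * norm (grade_scale s x)"
proof -
  have "\<bar>ext_coeff x A\<bar> \<le> (1 / s) ^ CARD('n) * \<bar>s ^ card A * ext_coeff x A\<bar>" for A
  proof -
    have "s ^ CARD('n) \<le> s ^ card A"
      using assms by (intro power_decreasing card_mono) auto
    then have "1 \<le> (1 / s) ^ CARD('n) * s ^ card A"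
      using assms by (simp add: power_divide)
    then have "1 * \<bar>ext_coeff x A\<bar> \<le> (1 / s) ^ CARD('n) * s ^ card A * \<bar>ext_coeff x A\<bar>"
      by (intro mult_right_mono) auto
    then show ?thesis using assms by (simp add: abs_mult mult.assoc)
  qed
  then show ?thesis
    unfolding norm_exterior_def grade_scale_def ext_coeff_Ext sum_distrib_left by (rule sum_mono)
qed

lemma norm_grade_scale_le:
  fixes x :: "'n::{finite,linorder} exterior"
  assumes "0 < s" "s \<le> 1" "degree_part 0 x = 0"
  shows "norm (grade_scale s x) \<le> s * norm x"
proof -
  have "\<bar>s ^ card A * ext_coeff x A\<bar> \<le> s * \<bar>ext_coeff x A\<bar>" for A
  proof (cases "A = {}")
    case True
    have "ext_coeff (degree_part 0 x) {} = 0" by (simp only: assms ext_coeff_simps)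
    then show ?thesis using True by simp
  next
    case False
    then have "1 \<le> card A" by (simp add: Suc_le_eq card_gt_0_iff)
    then have "s ^ card A \<le> s ^ 1" using assms by (intro power_decreasing) auto
    then show ?thesis using assms by (simp add: abs_mult mult_right_mono)
  qed
  then show ?thesis
    unfolding norm_exterior_def grade_scale_def ext_coeff_Ext sum_distrib_left by (rule sum_mono)
qed

section \<open>Degree components of matrices of forms\<close>

abbreviation mat_degree_part :: "nat \<Rightarrow> 'n::{finite,linorder} form_matrix \<Rightarrow> 'n form_matrix" where
  "mat_degree_part d \<equiv> map_matrix (degree_part d)"

lemma degree_part_add [simp]: "degree_part d (x + y) = degree_part d x + degree_part d y"
  and degree_part_diff [simp]: "degree_part d (x - y) = degree_part d x - degree_part d y"
  and degree_part_0 [simp]: "degree_part d 0 = 0"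
  and degree_part_scaleR [simp]: "degree_part d (a *\<^sub>R x) = a *\<^sub>R degree_part d x"
  by (auto intro!: exterior_eqI)

lemma degree_part_sum [simp]: "degree_part d (\<Sum>i\<in>I. f i) = (\<Sum>i\<in>I. degree_part d (f i))"
  by (auto intro!: exterior_eqI)

lemma bounded_linear_mat_degree_part: "bounded_linear (mat_degree_part d)"
proof (rule bounded_linear_intro)
  fix M :: "'n::{finite,linorder} form_matrix"
  show "norm (mat_degree_part d M) \<le> norm M * 1"
    using norm_matrix_mono[of "mat_degree_part d M" 1 M] by (simp add: norm_degree_part_le)
qed (simp_all add: vec_eq_iff)

lemma mat_degree_part_mult: "mat_degree_part d (M ** N) = (\<Sum>i\<le>d. mat_degree_part i M ** mat_degree_part (d - i) N)"
proof -
  have "(mat_degree_part d (M ** N)) $ i $ j = (\<Sum>p\<le>d. mat_degree_part p M ** mat_degree_part (d - p) N) $ i $ j" for i j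
    by (simp add: matrix_matrix_mult_def degree_part_mult) (rule sum.swap)
  then show ?thesis by (simp add: vec_eq_iff)
qed

lemma trace_mat_degree_part: "trace (mat_degree_part d M) = degree_part d (trace M)"
  by (simp add: trace_def)

lemma mat_degree_part_map_of_real [simp]:
  "mat_degree_part d (map_matrix of_real A) = (if d = 0 then map_matrix of_real A else 0)"
  by (auto simp: vec_eq_iff)

lemma map_matrix_of_real_mult:
  "map_matrix of_real (A ** B) = (map_matrix of_real A ** map_matrix of_real B :: 'a::real_normed_algebra_1^_^_)"
  by (simp add: vec_eq_iff matrix_matrix_mult_def)

lemma map_matrix_of_real_mat_1: "map_matrix of_real (mat 1) = mat 1"
  by (simp add: vec_eq_iff mat_def)

lemma mat_power_map_of_real:
  "mat_power (map_matrix of_real A) n = (map_matrix of_real (mat_power A n) :: 'a::real_normed_algebra_1^_^_)"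
  by (induction n) (simp_all add: map_matrix_of_real_mult map_matrix_of_real_mat_1)

lemma norm_map_of_real: "norm (map_matrix of_real A :: 'a::real_normed_algebra_1^_^_) = norm (A :: real^_^_)"
  by (simp add: norm_vec_def)

lemma trace_scalar_rotate:
  fixes M :: "'a::real_normed_algebra_1^'n^'n"
  shows "trace (map_matrix of_real A ** M) = trace (M ** map_matrix of_real A)"
  by (rule trace_mult_commute_central) (simp add: of_real_def)

text \<open>If \<open>N\<close> is homogeneous of degree \<open>k > 0\<close>, a word in \<open>S\<close> and \<open>N\<close> has degree \<open>k\<close> times the number
  of its letters \<open>N\<close>. Hence the lowest degrees of \<open>(S + N)\<^sup>n\<close> are \<open>S\<^sup>n\<close> in degree 0 and
  \<open>H_n(S, N)\<close> in degree \<open>k\<close>.\<close>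

lemma mat_degree_part_mat_power:
  fixes A :: "real^'n::{finite,linorder}^'n::{finite,linorder}" and N :: "'n form_matrix"
  defines "S \<equiv> map_matrix of_real A"
  assumes N: "\<And>d. mat_degree_part d N = (if d = k then N else 0)" and k: "0 < k"
  shows "mat_degree_part 0 (mat_power (S + N) n) = mat_power S n"
    and "0 < j \<Longrightarrow> j < k \<Longrightarrow> mat_degree_part j (mat_power (S + N) n) = 0"
    and "mat_degree_part k (mat_power (S + N) n) = H_poly n S N"
proof -
  have S: "mat_degree_part d S = (if d = 0 then S else 0)" for d
    by (simp add: S_def)
  have step: "mat_degree_part j ((S + N) ** P) = S ** mat_degree_part j P + (if k \<le> j then N ** mat_degree_part (j - k) P else 0)"
    for j and P :: "'n form_matrix"
  proof -
    have add: "mat_degree_part d (S + N) = mat_degree_part d S + mat_degree_part d N" for d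
      by (rule linear_add[OF bounded_linear.linear[OF bounded_linear_mat_degree_part]])
    have "mat_degree_part j ((S + N) ** P) =
      (\<Sum>i\<le>j. (if i = 0 then S ** mat_degree_part j P else 0) + (if i = k then N ** mat_degree_part (j - k) P else 0))"
      unfolding mat_degree_part_mult add S N using k
      by (intro sum.cong refl) (auto simp: matrix_mult.add_left)
    then show ?thesis by (simp add: sum.distrib)
  qed
  have one: "mat_degree_part d (mat 1) = (if d = 0 then mat 1 else 0 :: 'n form_matrix)" for d
    using mat_degree_part_map_of_real[of d "mat 1"] unfolding map_matrix_of_real_mat_1 .
  show zero: "mat_degree_part 0 (mat_power (S + N) n) = mat_power S n" for n
    by (induction n) (use k in \<open>simp_all add: step one\<close>)
  show "mat_degree_part j (mat_power (S + N) n) = 0" if "0 < j" "j < k"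
    by (induction n) (use that in \<open>simp_all add: step one\<close>)
  show "mat_degree_part k (mat_power (S + N) n) = H_poly n S N"
    by (induction n) (use k in \<open>simp_all add: step one H_poly_Suc zero\<close>)
qed

lemma grade_scale_mat_power:
  fixes M :: "'n::{finite,linorder} form_matrix"
  shows "map_matrix (grade_scale s) (mat_power M n) = mat_power (map_matrix (grade_scale s) M) n"
proof (induction n)
  case 0
  show ?case
    using grade_scale_of_real[of s 0] grade_scale_of_real[of s 1]
    by (auto simp: vec_eq_iff mat_def simp del: grade_scale_of_real)
next
  case (Suc n)
  have "map_matrix (grade_scale s) (P ** Q) =
    map_matrix (grade_scale s) P ** map_matrix (grade_scale s) Q" for P Q :: "'n form_matrix"
    by (simp add: vec_eq_iff matrix_matrix_mult_def grade_scale_sum grade_scale_mult)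
  with Suc show ?case by simp
qed

section \<open>Power series and exponentials of forms\<close>

text \<open>A perturbation \<open>N\<close> of positive degree does not disturb convergence, however large it is:
  applying a grading automorphism makes \<open>N\<close> as small as desired and leaves the scalar matrix \<open>A\<close>
  alone, so the powers still grow at most like \<open>\<rho>\<^sup>n\<close> for any \<open>\<rho> > r\<close>.\<close>

lemma summable_power_series_nilpotent_perturbation:
  fixes A :: "real^'n::{finite,linorder}^'n::{finite,linorder}" and N :: "'n form_matrix"
  assumes A: "\<And>n. norm (mat_power A n) \<le> C * r ^ n" and r: "0 \<le> r" "ereal r < conv_radius c"
    and N: "mat_degree_part 0 N = 0"
  shows "summable (\<lambda>n. c n *\<^sub>R mat_power (map_matrix of_real A + N) n)"
proof -
  let ?S = "map_matrix of_real A :: 'n form_matrix" and ?G = "\<lambda>s. map_matrix (grade_scale s)"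
  have C: "0 \<le> C" using order.trans[OF norm_ge_zero A[of 0]] by simp
  obtain \<rho> where \<rho>: "r < \<rho>" "ereal \<rho> < conv_radius c"
    using ereal_dense2[OF r(2)] by auto
  \<comment> \<open>chosen so that \<open>r + C s |N| \<le> \<rho>\<close>; the \<open>+ 1\<close> avoids division by zero\<close>
  define s where "s = min 1 ((\<rho> - r) / (C * norm N + 1))"
  have pos: "0 < C * norm N + 1" using C by (simp add: add_nonneg_pos)
  have s: "0 < s" "s \<le> 1" using \<rho>(1) pos by (auto simp: s_def)
  have "C * (s * norm N) \<le> s * (C * norm N + 1)" using s by (simp add: algebra_simps)
  also have "\<dots> \<le> (\<rho> - r) / (C * norm N + 1) * (C * norm N + 1)"
    by (rule mult_right_mono) (use pos in \<open>auto simp: s_def\<close>)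
  finally have small: "r + C * (s * norm N) \<le> \<rho>" using pos by simp
  have "norm (grade_scale s (N $ i $ j)) \<le> s * norm (N $ i $ j)" for i j
    by (rule norm_grade_scale_le[OF s]) (use N in \<open>simp add: vec_eq_iff\<close>)
  then have GN: "norm (?G s N) \<le> s * norm N"
    using norm_matrix_mono[of "?G s N" s N] s by simp
  have GSN: "?G s (?S + N) = ?S + ?G s N"
    by (simp add: vec_eq_iff grade_scale_add)
  have bound: "norm (mat_power (?S + N) n) \<le> (1 / s) ^ CARD('n) * (C * \<rho> ^ n)" for n
  proof -
    have "norm (mat_power (?S + N) n) \<le> (1 / s) ^ CARD('n) * norm (?G s (mat_power (?S + N) n))"
      by (rule norm_matrix_mono) (use norm_grade_scale_ge[OF s] s in auto)
    also have "norm (?G s (mat_power (?S + N) n)) = norm (mat_power ?S 0 ** mat_power (?S + ?G s N) n)"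
      by (simp add: grade_scale_mat_power GSN)
    also have "\<dots> \<le> C * r ^ 0 * (r + C * norm (?G s N)) ^ n"
      by (rule mat_power_perturbed_bound) (use A r in \<open>simp_all add: mat_power_map_of_real norm_map_of_real\<close>)
    also have "\<dots> \<le> C * \<rho> ^ n"
      using C r(1) small mult_left_mono[OF GN C] by (auto intro!: mult_left_mono power_mono)
    finally show ?thesis using s by (simp add: mult_left_mono)
  qed
  have "summable (\<lambda>n. norm (c n * \<rho> ^ n))"
    using \<rho> r by (intro abs_summable_in_conv_radius) auto
  then have "summable (\<lambda>n. (1 / s) ^ CARD('n) * C * norm (c n * \<rho> ^ n))"
    by (rule summable_mult)
  then show ?thesis
  proof (rule summable_comparison_test'[where N = 0])
    fix n
    have "\<bar>c n\<bar> * norm (mat_power (?S + N) n) \<le> \<bar>c n\<bar> * ((1 / s) ^ CARD('n) * (C * \<rho> ^ n))"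
      by (rule mult_left_mono[OF bound]) simp
    then show "norm (c n *\<^sub>R mat_power (?S + N) n) \<le> (1 / s) ^ CARD('n) * C * norm (c n * \<rho> ^ n)"
      using \<rho> r by (simp add: abs_mult mult_ac)
  qed
qed

text \<open>Splitting off the central scalar part, \<open>exp x = exp a exp N\<close> with \<open>N\<close> starting in degree 2;
  then \<open>N\<^sup>2\<close> and all higher powers start in degree 4 and are invisible in degrees up to 2.\<close>

lemma degree_part_exp:
  fixes x :: "'n::{finite,linorder} exterior"
  assumes "degree_part 1 x = 0"
  shows "degree_part 0 (exp x) = exp (degree_part 0 x)"
    and "degree_part 1 (exp x) = 0"
    and "degree_part 2 (exp x) = exp (degree_part 0 x) * degree_part 2 x"
proof -
  define a where "a = ext_coeff x {}"
  define N where "N = x - of_real a"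
  have x0: "degree_part 0 x = of_real a" by (simp add: degree_part_0_eq a_def)
  have N: "degree_part 0 N = 0" "degree_part 1 N = 0" "degree_part 2 N = degree_part 2 x"
    using assms by (simp_all add: N_def x0)
  have "exp x = exp (of_real a + N)" by (simp add: N_def)
  also have "\<dots> = exp (of_real a) * exp N"
    by (rule exp_add_commuting) (simp add: of_real_def)
  finally have exp_x: "exp x = exp a *\<^sub>R exp N"
    by (simp only: exp_of_real scaleR_conv_of_real)
  have high: "degree_part d (N ^ n) = 0" if "2 \<le> n" "d \<le> 2" for n d
  proof -
    obtain m where "n = Suc (Suc m)" using \<open>2 \<le> n\<close> by (auto simp: le_iff_add)
    moreover have "d = 0 \<or> d = 1 \<or> d = 2" using \<open>d \<le> 2\<close> by auto
    ultimately show ?thesis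
      using N by (auto simp: degree_part_mult numeral_2_eq_2)
  qed
  have exp_N: "degree_part d (exp N) = degree_part d 1 + degree_part d N" if "d \<le> 2" for d
  proof -
    have "degree_part d (exp N) = (\<Sum>n. degree_part d (N ^ n /\<^sub>R fact n))"
      unfolding exp_def by (rule bounded_linear.suminf[OF bounded_linear_degree_part summable_exp_generic])
    also have "\<dots> = (\<Sum>n\<in>{0, 1}. degree_part d (N ^ n /\<^sub>R fact n))"
    proof (rule suminf_finite)
      fix n :: nat assume "n \<notin> {0, 1}"
      then have "2 \<le> n" by auto
      then show "degree_part d (N ^ n /\<^sub>R fact n) = 0" using high that by simp
    qed simp
    finally show ?thesis by simp
  qed
  have one: "degree_part d (1 :: 'n exterior) = (if d = 0 then 1 else 0)" for d
    using degree_part_of_real[of d 1] unfolding of_real_1 .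
  have part: "degree_part d (exp x) = of_real (exp a) * (degree_part d 1 + degree_part d N)" if "d \<le> 2" for d
    unfolding exp_x degree_part_scaleR exp_N[OF that] by (simp only: scaleR_conv_of_real)
  show "degree_part 0 (exp x) = exp (degree_part 0 x)"
    unfolding x0 exp_of_real by (simp only: part one N) simp
  show "degree_part 1 (exp x) = 0"
    unfolding x0 exp_of_real by (simp only: part one N) simp
  show "degree_part 2 (exp x) = exp (degree_part 0 x) * degree_part 2 x"
    unfolding x0 exp_of_real by (simp only: part one N) simp
qed

section \<open>Parity of the Taylor coefficients\<close>

text \<open>\<open>L_f\<close> with a complex argument and the principal logarithm, a holomorphic extension near 0. The
  quotient \<open>sinh z / z\<close> is isolated because it carries the removable singularity.\<close>

definition L_f_complex :: "complex \<Rightarrow> complex" where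
  "L_f_complex z = Ln (cosh (z / 2) / (if z / 2 = 0 then 1 else sinh (z / 2) / (z / 2))) / 2"

text \<open>The singularity of \<open>sinh z / z\<close> at 0 is removable, and near 0 the quotient
  under the logarithm stays in the right half-plane, where the principal branch is holomorphic.\<close>

lemma L_f_holomorphic_extension:
  obtains \<delta> where "0 < \<delta>" "L_f_complex holomorphic_on ball 0 \<delta>"
    "\<And>x. \<bar>x\<bar> < \<delta> \<Longrightarrow> L_f_complex (of_real x) = of_real (L_f x)"
proof -
  define S :: "complex \<Rightarrow> complex" where "S z = (if z = 0 then 1 else sinh z / z)" for z
  define G where "G z = cosh (z / 2) / S (z / 2)" for z
  have F: "L_f_complex z = Ln (G z) / 2" for z
    by (simp add: L_f_complex_def G_def S_def)
  have hyperbolic: "sinh holomorphic_on A" "(\<lambda>z. cosh (z / 2)) holomorphic_on A" for A :: "complex set"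
    unfolding sinh_field_def[abs_def] cosh_field_def[abs_def] by (intro holomorphic_intros; simp)+
  have "((sinh :: complex \<Rightarrow> complex) has_field_derivative 1) (at 0)"
    by (auto intro!: derivative_eq_intros)
  then have "(\<lambda>z::complex. sinh z / z) \<midarrow>0\<rightarrow> 1"
    by (simp add: DERIV_def)
  then have S: "S holomorphic_on UNIV"
    unfolding S_def
    by (intro removable_singularity holomorphic_intros hyperbolic) auto
  have S_half: "(\<lambda>z. S (z / 2)) holomorphic_on A" for A
  proof -
    have "(\<lambda>z. z / 2) holomorphic_on A" by (intro holomorphic_intros) auto
    from holomorphic_on_compose_gen[OF this S] show ?thesis by (simp add: o_def)
  qed
  have S0: "S 0 = 1" by (simp add: S_def)
  have contS: "isCont (\<lambda>z. S (z / 2)) 0"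
    using holomorphic_on_imp_continuous_on[OF S_half[of UNIV]] by (simp add: continuous_on_eq_continuous_at)
  then have contG: "isCont G 0"
    unfolding G_def using S0 by (intro continuous_intros) auto
  have "eventually (\<lambda>z. S (z / 2) \<noteq> 0) (nhds 0)"
    using S0 by (intro tendsto_imp_eventually_ne[OF tendsto_at_iff_tendsto_nhds[THEN iffD1, OF contS[unfolded isCont_def]]]) simp
  moreover have "((\<lambda>z. Re (G z)) \<longlongrightarrow> Re (G 0)) (nhds 0)"
    by (intro tendsto_Re tendsto_at_iff_tendsto_nhds[THEN iffD1] contG[unfolded isCont_def])
  then have "eventually (\<lambda>z. 0 < Re (G z)) (nhds 0)"
    by (rule order_tendstoD) (simp add: G_def S0)
  ultimately have "eventually (\<lambda>z. S (z / 2) \<noteq> 0 \<and> 0 < Re (G z)) (nhds 0)"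
    by (rule eventually_conj)
  then obtain \<delta> where \<delta>: "0 < \<delta>" "\<And>z. dist z 0 < \<delta> \<Longrightarrow> S (z / 2) \<noteq> 0 \<and> 0 < Re (G z)"
    unfolding eventually_nhds_metric by blast
  have "G holomorphic_on ball 0 \<delta>"
    unfolding G_def using \<delta> by (intro holomorphic_intros hyperbolic S_half) (auto simp: dist_commute)
  then have "(\<lambda>z. Ln (G z) / 2) holomorphic_on ball 0 \<delta>"
    using \<delta> by (intro holomorphic_intros) (force simp: complex_nonpos_Reals_iff)+
  then have "L_f_complex holomorphic_on ball 0 \<delta>" by (simp add: F[abs_def])
  moreover have "L_f_complex (of_real x) = of_real (L_f x)" if "\<bar>x\<bar> < \<delta>" for x
  proof -
    have "cosh (complex_of_real y) = of_real (cosh y)" "sinh (complex_of_real y) = of_real (sinh y)" for y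
      by (simp_all add: cosh_field_def sinh_field_def flip: exp_of_real)
    from this[of "x / 2"] have G: "G (of_real x) = of_real (L_ftilde x)"
      by (simp add: G_def S_def L_ftilde_def tanh_def mult.commute)
    have "0 < L_ftilde x" using \<delta>(2)[of "of_real x"] that by (simp add: G)
    then show ?thesis unfolding F G L_f_def by (simp add: Ln_of_real)
  qed
  ultimately show ?thesis using \<delta>(1) that by blast
qed

text \<open>Evenness alone does not determine the iterates of \<open>deriv\<close>, whose value is arbitrary where a
  function is not differentiable. The holomorphic extension supplies differentiability to all orders
  near 0, and on the complex side the chain rule for \<open>w \<mapsto> - w\<close> kills the odd derivatives at 0.\<close>

lemma taylor_coeff_L_f_odd:
  assumes "odd n"
  shows "taylor_coeff L_f n = 0"
proof -
  obtain \<delta> where \<delta>: "0 < \<delta>" "L_f_complex holomorphic_on ball 0 \<delta>"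
    "\<And>x. \<bar>x\<bar> < \<delta> \<Longrightarrow> L_f_complex (of_real x) = of_real (L_f x)"
    using L_f_holomorphic_extension by blast
  have real: "(deriv ^^ n) L_f x = Re ((deriv ^^ n) L_f_complex (of_real x))" if "\<bar>x\<bar> < \<delta>" for n x
    using that
  proof (induction n arbitrary: x)
    case 0
    then show ?case using \<delta>(3) by simp
  next
    case (Suc n)
    let ?H = "(deriv ^^ n) L_f_complex"
    have "?H holomorphic_on ball 0 \<delta>" by (intro holomorphic_higher_deriv \<delta>) simp
    then have "(?H has_field_derivative deriv ?H (of_real x)) (at (of_real x))"
      using Suc.prems by (intro holomorphic_derivI[where S = "ball 0 \<delta>"]) auto
    then have "((\<lambda>y. Re (?H (of_real y))) has_real_derivative Re (deriv ?H (of_real x))) (at x)"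
      by (intro has_field_derivative_Re has_vector_derivative_real_field)
    moreover have "eventually (\<lambda>y. Re (?H (of_real y)) = (deriv ^^ n) L_f y) (nhds x)"
    proof (rule eventually_nhds_in_open[THEN eventually_mono])
      show "open {-\<delta><..<\<delta>}" "x \<in> {-\<delta><..<\<delta>}" using Suc.prems by auto
      show "Re (?H (of_real y)) = (deriv ^^ n) L_f y" if "y \<in> {-\<delta><..<\<delta>}" for y
        using Suc.IH[of y] that by (simp add: abs_less_iff)
    qed
    ultimately have "((deriv ^^ n) L_f has_real_derivative Re (deriv ?H (of_real x))) (at x)"
      using DERIV_cong_ev[OF refl, of _ _ x "Re (deriv ?H (of_real x))"] by simp
    then show ?case by (simp add: DERIV_imp_deriv)
  qed
  have "(\<lambda>w. L_f_complex (- 1 * w)) = L_f_complex"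
    by (auto simp: L_f_complex_def fun_eq_iff)
  then have "(deriv ^^ n) L_f_complex 0 = (- 1) ^ n * (deriv ^^ n) L_f_complex 0"
    using higher_deriv_compose_linear[of L_f_complex "ball 0 \<delta>" "ball 0 \<delta>" 0 "- 1" n] \<delta> by simp
  then have "(deriv ^^ n) L_f_complex 0 = 0" using assms by simp
  then show ?thesis using real[of 0 n] \<delta>(1) by (simp add: taylor_coeff_def)
qed

section \<open>The degree 3 part of the transgression integrand\<close>

lemma taylor_coeff_deriv: "taylor_coeff (deriv p) n = of_nat (Suc n) * taylor_coeff p (Suc n)"
proof -
  have "(deriv ^^ n) (deriv p) = (deriv ^^ Suc n) p" by (simp only: funpow_Suc_right o_apply)
  then show ?thesis by (simp add: taylor_coeff_def del: funpow.simps of_nat_Suc)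
qed

lemma conv_radius_taylor_coeff_deriv:
  "conv_radius (taylor_coeff p) \<le> conv_radius (taylor_coeff (deriv p))"
proof -
  have "fps_nth (fps_deriv (Abs_fps (taylor_coeff p))) = taylor_coeff (deriv p)"
    by (simp add: fun_eq_iff taylor_coeff_deriv)
  then show ?thesis
    using fps_conv_radius_deriv[of "Abs_fps (taylor_coeff p)"] by (simp add: fps_conv_radius_def)
qed

text \<open>The coefficients \<open>f\<^sup>(\<^sup>n\<^sup>+\<^sup>1\<^sup>)(0) / n!\<close> are those of the Taylor series of \<open>f'\<close>, so \<open>f\<^sup>[\<^sup>2\<^sup>](a) * b\<close> is the part
  of \<open>f'(a + b)\<close> linear in \<open>b\<close>.\<close>

lemma second_quot_eq: "second_quot p a b = (\<Sum>n. taylor_coeff (deriv p) n *\<^sub>R H_poly n a b)"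
proof -
  have "(deriv ^^ (n + 1)) p 0 / fact n = taylor_coeff (deriv p) n" for n
    by (simp only: taylor_coeff_def Suc_eq_plus1[symmetric] funpow_Suc_right o_apply)
  then show ?thesis by (simp only: second_quot_def)
qed

text \<open>Degree components are bounded linear, so they can be taken term by term in the power series.\<close>

lemma mat_fun_graded:
  fixes A :: "real^'n::{finite,linorder}^'n::{finite,linorder}" and N :: "'n form_matrix"
  defines "S \<equiv> map_matrix of_real A"
  assumes A: "\<And>n. norm (mat_power A n) \<le> C * r ^ n" "0 \<le> r" "ereal r < conv_radius (taylor_coeff p)"
    and N: "\<And>d. mat_degree_part d N = (if d = k then N else 0)" and k: "0 < k"
  shows "(\<lambda>n. taylor_coeff p n *\<^sub>R mat_power S n) sums mat_fun p S"
    and "mat_degree_part 0 (mat_fun p (S + N)) = mat_fun p S"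
    and "0 < j \<Longrightarrow> j < k \<Longrightarrow> mat_degree_part j (mat_fun p (S + N)) = 0"
    and "(\<lambda>n. taylor_coeff p n *\<^sub>R H_poly n S N) sums mat_degree_part k (mat_fun p (S + N))"
proof -
  \<comment> \<open>without convergence, the series in \<^const>\<open>mat_fun\<close> would have an unspecified value\<close>
  have "mat_degree_part 0 N = 0" using N[of 0] k by simp
  then have "(\<lambda>n. taylor_coeff p n *\<^sub>R mat_power (S + N) n) sums mat_fun p (S + N)"
    unfolding mat_fun_def S_def
    by (intro summable_sums summable_power_series_nilpotent_perturbation[OF A])
  then have part: "(\<lambda>n. mat_degree_part d (taylor_coeff p n *\<^sub>R mat_power (S + N) n)) sums mat_degree_part d (mat_fun p (S + N))" for d
    by (rule bounded_linear.sums[OF bounded_linear_mat_degree_part])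
  have scale: "mat_degree_part d (c *\<^sub>R M) = c *\<^sub>R mat_degree_part d M" for d c and M :: "'n form_matrix"
    by (simp add: vec_eq_iff)
  note pow = mat_degree_part_mat_power[where N = N and k = k and A = A, folded S_def, OF N k]
  show 1: "(\<lambda>n. taylor_coeff p n *\<^sub>R mat_power S n) sums mat_fun p S"
    using part[of 0] unfolding scale pow by (simp add: mat_fun_def sums_iff)
  then show "mat_degree_part 0 (mat_fun p (S + N)) = mat_fun p S"
    using part[of 0] unfolding scale pow by (rule sums_unique2[symmetric])
  show "mat_degree_part j (mat_fun p (S + N)) = 0" if "0 < j" "j < k"
    using part[of j] pow(2)[OF that] unfolding scale by (simp add: sums_unique2)
  show "(\<lambda>n. taylor_coeff p n *\<^sub>R H_poly n S N) sums mat_degree_part k (mat_fun p (S + N))"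
    using part[of k] unfolding scale pow .
qed

lemma mat_power_minus:
  fixes A :: "'a::real_normed_algebra_1^'n^'n"
  shows "mat_power (- A) n = (- 1) ^ n *\<^sub>R mat_power A n"
  by (induction n) (simp_all add: matrix_mult.minus_left matrix_mult.scaleR_right)

lemma mat_power_add:
  fixes A :: "'a::real_normed_algebra_1^'n^'n"
  shows "mat_power A (m + n) = mat_power A m ** mat_power A n"
  by (induction m) (simp_all add: matrix_mul_assoc)

lemma H_poly_minus:
  fixes a b :: "'a::real_normed_algebra_1^'n^'n"
  shows "H_poly n (- a) b = (- ((- 1) ^ n)) *\<^sub>R H_poly n a b"
proof -
  have "mat_power (- a) q ** b ** mat_power (- a) (n - 1 - q) =
    (- ((- 1) ^ n)) *\<^sub>R (mat_power a q ** b ** mat_power a (n - 1 - q))" if "q < n" for q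
  proof -
    have "(- 1 :: real) ^ n = (- 1) ^ Suc (q + (n - 1 - q))" using that by simp
    then have "- ((- 1 :: real) ^ n) = (- 1) ^ q * (- 1) ^ (n - 1 - q)"
      by (simp add: power_add)
    then show ?thesis
      by (simp add: mat_power_minus matrix_mult.scaleR_left matrix_mult.scaleR_right mult.commute)
  qed
  then show ?thesis by (simp add: H_poly_def scaleR_sum_right)
qed

lemma trace_sum: "trace (\<Sum>i\<in>I. f i :: 'a::real_normed_algebra_1^'n^'n) = (\<Sum>i\<in>I. trace (f i))"
  by (rule linear_sum[OF bounded_linear.linear[OF bounded_linear_trace]])

text \<open>Rotating the scalar powers around the trace exchanges the two slots and reverses the order of
  the summation index \<open>q\<close>.\<close>

lemma trace_H_poly_mult:
  fixes \<Theta> R :: "'a::real_normed_algebra_1^'n^'n" and A :: "real^'n^'n"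
  defines "S \<equiv> map_matrix of_real A"
  shows "trace (H_poly n S \<Theta> ** R) = trace (\<Theta> ** H_poly n S R)"
proof -
  let ?t = "\<lambda>q. trace (\<Theta> ** (mat_power S (n - 1 - q) ** R ** mat_power S q))"
  have "trace (mat_power S q ** \<Theta> ** mat_power S m ** R) = trace (\<Theta> ** (mat_power S m ** R ** mat_power S q))" for q m
    unfolding S_def mat_power_map_of_real
    by (simp add: trace_scalar_rotate matrix_mul_assoc[symmetric])
  then have "trace (H_poly n S \<Theta> ** R) = (\<Sum>q<n. ?t q)"
    by (simp add: H_poly_def matrix_mult.sum_left trace_sum)
  also have "\<dots> = (\<Sum>q<n. ?t (n - Suc q))"
    by (rule sum.nat_diff_reindex[symmetric])
  also have "\<dots> = (\<Sum>q<n. trace (\<Theta> ** (mat_power S q ** R ** mat_power S (n - 1 - q))))"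
    by (intro sum.cong refl) simp
  also have "\<dots> = trace (\<Theta> ** H_poly n S R)"
    by (simp add: H_poly_def matrix_mult.sum_right trace_sum)
  finally show ?thesis .
qed

lemma trace_H_poly:
  fixes R :: "'a::real_normed_algebra_1^'n^'n" and A :: "real^'n^'n"
  defines "S \<equiv> map_matrix of_real A"
  shows "trace (H_poly (Suc n) S R) = of_nat (Suc n) *\<^sub>R trace (mat_power S n ** R)"
proof -
  have "trace (mat_power S q ** R ** mat_power S (n - q)) = trace (mat_power S n ** R)" if "q \<le> n" for q
  proof -
    have "trace (mat_power S q ** R ** mat_power S (n - q)) =
        trace (mat_power S (n - q) ** (mat_power S q ** R))"
      unfolding S_def mat_power_map_of_real by (rule trace_scalar_rotate[symmetric])
    also have "\<dots> = trace (mat_power S (n - q + q) ** R)"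
      by (simp only: mat_power_add matrix_mul_assoc)
    finally show ?thesis using that by simp
  qed
  then have "trace (H_poly (Suc n) S R) = (\<Sum>q<Suc n. trace (mat_power S n ** R))"
    unfolding H_poly_def trace_sum by (intro sum.cong refl) simp
  then show ?thesis by (simp only: sum_constant_scaleR card_lessThan)
qed

lemma bounded_linear_trace_mult_left:
  "bounded_linear (\<lambda>M. trace (P ** M) :: 'a::real_normed_algebra_1)"
  by (rule bounded_linear_compose[OF bounded_linear_trace matrix_mult.bounded_linear_right])

lemma bounded_linear_trace_mult_right:
  "bounded_linear (\<lambda>M. trace (M ** P) :: 'a::real_normed_algebra_1)"
  by (rule bounded_linear_compose[OF bounded_linear_trace matrix_mult.bounded_linear_left])

text \<open>Let \<open>T = Tr p(R - S)\<close> and \<open>U = Tr (\<Theta> p'(R - S))\<close>. As \<open>T\<close> has no part of degree 1 and \<open>U\<close> none of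
  degree 0, the degree 3 part of \<open>exp(T) U\<close> is \<open>exp(T\<^sub>0) (T\<^sub>2 U\<^sub>1 + U\<^sub>3)\<close>. The signs come from the parity
  of \<open>p\<close>: since \<open>p(-S) = p(S)\<close> and \<open>p'(-S) = - p'(S)\<close>, both \<open>T\<^sub>2\<close> and \<open>U\<^sub>1\<close> carry a minus sign, which
  cancel, while \<open>U\<^sub>3\<close> only involves \<open>H_n(-S, R)\<close> with \<open>n\<close> odd and is unaffected.\<close>

lemma degree_3_transgression_integrand:
  fixes A :: "real^'n::{finite,linorder}^'n::{finite,linorder}" and R \<Theta> :: "'n form_matrix"
  defines "S \<equiv> map_matrix of_real A"
  assumes A: "\<And>n. norm (mat_power A n) \<le> C * r ^ n" "0 \<le> r" "ereal r < conv_radius (taylor_coeff p)"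
    and even: "\<And>n. odd n \<Longrightarrow> taylor_coeff p n = 0"
    and R: "\<And>d. mat_degree_part d R = (if d = 2 then R else 0)"
    and \<Theta>: "\<And>d. mat_degree_part d \<Theta> = (if d = 1 then \<Theta> else 0)"
  shows "degree_part 3 (exp (trace (mat_fun p (R - S))) * trace (\<Theta> ** mat_fun (deriv p) (R - S))) =
    exp (trace (mat_fun p S)) *
      (trace (\<Theta> ** mat_fun (deriv p) S) * trace (mat_fun (deriv p) S ** R) + trace (second_quot p S \<Theta> ** R))"
proof -
  let ?p' = "deriv p" and ?c = "taylor_coeff p" and ?c' = "taylor_coeff (deriv p)"
  define T where "T = trace (mat_fun p (R - S))"
  define U where "U = trace (\<Theta> ** mat_fun ?p' (R - S))"
  have S_minus: "map_matrix of_real (- A) = - S" and RS: "R - S = - S + R"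
    by (simp_all add: S_def vec_eq_iff)
  have A_minus: "norm (mat_power (- A) n) \<le> C * r ^ n" for n
    using A(1) by (simp add: mat_power_minus)
  have r': "ereal r < conv_radius ?c'"
    using A(3) conv_radius_taylor_coeff_deriv order.strict_trans2 by blast
  note f = mat_fun_graded[OF A_minus A(2,3) R, unfolded S_minus, folded RS, simplified]
    and f' = mat_fun_graded[OF A_minus A(2) r' R, unfolded S_minus, folded RS, simplified]
    and g' = mat_fun_graded[OF A(1,2) r' \<Theta>, folded S_def, simplified]
  have even': "?c' n = 0" if "even n" for n
    using even[of "Suc n"] that by (simp add: taylor_coeff_deriv)
  have f_even: "mat_fun p (- S) = mat_fun p S"
  proof -
    have "?c n *\<^sub>R mat_power (- S) n = ?c n *\<^sub>R mat_power S n" for n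
      using even[of n] by (cases "even n") (simp_all add: mat_power_minus)
    then show ?thesis by (simp only: mat_fun_def)
  qed
  have f'_odd: "mat_fun ?p' (- S) = - mat_fun ?p' S"
  proof -
    have "?c' n *\<^sub>R mat_power (- S) n = - (?c' n *\<^sub>R mat_power S n)" for n
      using even'[of n] by (cases "even n") (simp_all add: mat_power_minus)
    then show ?thesis
      using sums_unique2[OF f'(1)] sums_minus[OF g'(1)] by simp
  qed
  have T0: "degree_part 0 T = trace (mat_fun p S)"
    unfolding T_def trace_mat_degree_part[symmetric] f f_even ..
  have T1: "degree_part 1 T = 0"
    unfolding T_def trace_mat_degree_part[symmetric] using f(3)[of 1] by (simp add: trace_def)
  have T2: "degree_part 2 T = - trace (mat_fun ?p' S ** R)"
  proof -
    have coeff_eq: "trace (?c (Suc n) *\<^sub>R H_poly (Suc n) (- S) R) = trace ((?c' n *\<^sub>R mat_power (- S) n) ** R)" for n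
    proof -
      have "trace (?c (Suc n) *\<^sub>R H_poly (Suc n) (- S) R) = ?c (Suc n) *\<^sub>R trace (H_poly (Suc n) (- S) R)"
        by (rule linear_cmul[OF bounded_linear.linear[OF bounded_linear_trace]])
      also have "\<dots> = ?c' n *\<^sub>R trace (mat_power (- S) n ** R)"
        by (simp add: trace_H_poly[of n "- A" R, unfolded S_minus] taylor_coeff_deriv)
      also have "\<dots> = trace ((?c' n *\<^sub>R mat_power (- S) n) ** R)"
        by (rule linear_cmul[OF bounded_linear.linear[OF bounded_linear_trace_mult_right], symmetric])
      finally show ?thesis .
    qed
    \<comment> \<open>the term for \<open>n = 0\<close> vanishes, so the index can be shifted\<close>
    have "(\<lambda>n. trace (?c n *\<^sub>R H_poly n (- S) R)) sums degree_part 2 T"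
      unfolding T_def trace_mat_degree_part[symmetric] by (rule bounded_linear.sums[OF bounded_linear_trace f(4)])
    then have "(\<lambda>n. trace ((?c' n *\<^sub>R mat_power (- S) n) ** R)) sums degree_part 2 T"
      unfolding coeff_eq[symmetric] by (subst sums_Suc_iff) (simp add: trace_def)
    moreover have "(\<lambda>n. trace ((?c' n *\<^sub>R mat_power (- S) n) ** R)) sums trace (mat_fun ?p' (- S) ** R)"
      by (rule bounded_linear.sums[OF bounded_linear_trace_mult_right f'(1)])
    ultimately have "degree_part 2 T = trace (mat_fun ?p' (- S) ** R)" by (rule sums_unique2)
    also have "\<dots> = - trace (mat_fun ?p' S ** R)"
      unfolding f'_odd by (rule linear_neg[OF bounded_linear.linear[OF bounded_linear_trace_mult_right]])
    finally show ?thesis .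
  qed
  have \<Theta>_mult: "degree_part d U = (if 1 \<le> d then trace (\<Theta> ** mat_degree_part (d - 1) (mat_fun ?p' (R - S))) else 0)" for d
  proof -
    have "mat_degree_part d (\<Theta> ** M) = (\<Sum>i\<le>d. if i = 1 then \<Theta> ** mat_degree_part (d - 1) M else 0)" for M
      unfolding mat_degree_part_mult by (intro sum.cong refl) (auto simp: \<Theta>)
    then show ?thesis
      unfolding U_def trace_mat_degree_part[symmetric] by (auto simp: trace_def)
  qed
  have U1: "degree_part 1 U = - trace (\<Theta> ** mat_fun ?p' S)"
    unfolding \<Theta>_mult
    using f'(2) f'_odd linear_neg[OF bounded_linear.linear[OF bounded_linear_trace_mult_left]] by simp
  have U3: "degree_part 3 U = trace (second_quot p S \<Theta> ** R)"
  proof -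
    have coeff_eq: "trace (\<Theta> ** (?c' n *\<^sub>R H_poly n (- S) R)) = trace ((?c' n *\<^sub>R H_poly n S \<Theta>) ** R)" for n
    proof -
      have "?c' n *\<^sub>R H_poly n (- S) R = ?c' n *\<^sub>R H_poly n S R"
        using even'[of n] by (cases "even n") (simp_all add: H_poly_minus)
      then have "trace (\<Theta> ** (?c' n *\<^sub>R H_poly n (- S) R)) = ?c' n *\<^sub>R trace (\<Theta> ** H_poly n S R)"
        by (simp only: linear_cmul[OF bounded_linear.linear[OF bounded_linear_trace_mult_left]])
      also have "\<dots> = ?c' n *\<^sub>R trace (H_poly n S \<Theta> ** R)"
        by (simp add: S_def trace_H_poly_mult)
      also have "\<dots> = trace ((?c' n *\<^sub>R H_poly n S \<Theta>) ** R)"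
        by (rule linear_cmul[OF bounded_linear.linear[OF bounded_linear_trace_mult_right], symmetric])
      finally show ?thesis .
    qed
    have "(\<lambda>n. trace ((?c' n *\<^sub>R H_poly n S \<Theta>) ** R)) sums trace (\<Theta> ** mat_degree_part 2 (mat_fun ?p' (R - S)))"
      using bounded_linear.sums[OF bounded_linear_trace_mult_left[of \<Theta>] f'(4)] unfolding coeff_eq .
    moreover have "(\<lambda>n. trace ((?c' n *\<^sub>R H_poly n S \<Theta>) ** R)) sums trace (second_quot p S \<Theta> ** R)"
      unfolding second_quot_eq
      by (rule bounded_linear.sums[OF bounded_linear_trace_mult_right summable_sums[OF sums_summable[OF g'(4)]]])
    ultimately have "trace (\<Theta> ** mat_degree_part 2 (mat_fun ?p' (R - S))) = trace (second_quot p S \<Theta> ** R)"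
      by (rule sums_unique2)
    then show ?thesis by (simp add: \<Theta>_mult)
  qed
  note expT = degree_part_exp[OF T1]
  have "degree_part 3 (exp T * U) = (\<Sum>i\<in>{0, 1, 2, 3}. degree_part i (exp T) * degree_part (3 - i) U)"
    unfolding degree_part_mult by (rule sum.cong) auto
  also have "\<dots> = exp (degree_part 0 T) * degree_part 3 U + exp (degree_part 0 T) * degree_part 2 T * degree_part 1 U"
    using \<Theta>_mult[of 0] by (simp add: expT expT[unfolded One_nat_def])
  also have "\<dots> = exp (degree_part 0 T) * (degree_part 1 U * degree_part 2 T + degree_part 3 U)"
    by (simp add: even_degree_commutes[of 2 T] distrib_left mult.assoc add.commute)
  also have "\<dots> = exp (trace (mat_fun p S)) *
      (trace (\<Theta> ** mat_fun ?p' S) * trace (mat_fun ?p' S ** R) + trace (second_quot p S \<Theta> ** R))"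
    unfolding T0 T2 U1 U3 by simp
  finally show ?thesis by (simp add: T_def U_def)
qed

section \<open>Frames, metrics and the transgression form\<close>

lemma lin_comb_in_tangent_space:
  assumes "frame_at \<A> x E"
  shows "lin_comb E x u \<in> tangent_space \<A> UNIV x"
proof -
  have E: "E i x \<in> tangent_space \<A> UNIV x" for i
    using assms by (simp add: frame_at_def vfields_def)
  show ?thesis
    unfolding tangent_space_def mem_Collect_eq
  proof (intro conjI ballI allI impI)
    fix h h' a b
    assume h: "h \<in> smooth_functions \<A> UNIV" "h' \<in> smooth_functions \<A> UNIV"
    have "E i x (\<lambda>y. a * h y + b * h' y) = a * E i x h + b * E i x h'" for i
      using E[of i] h unfolding tangent_space_def by blast
    then show "lin_comb E x u (\<lambda>y. a * h y + b * h' y) = a * lin_comb E x u h + b * lin_comb E x u h'"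
      by (simp add: lin_comb_def sum.distrib sum_distrib_left algebra_simps)
  next
    fix h h'
    assume h: "h \<in> smooth_functions \<A> UNIV" "h' \<in> smooth_functions \<A> UNIV"
    have "E i x (\<lambda>y. h y * h' y) = E i x h * h' x + h x * E i x h'" for i
      using E[of i] h unfolding tangent_space_def by blast
    then show "lin_comb E x u (\<lambda>y. h y * h' y) = lin_comb E x u h * h' x + h x * lin_comb E x u h'"
      by (simp add: lin_comb_def sum.distrib sum_distrib_left sum_distrib_right algebra_simps)
  next
    fix h h' :: "'a \<Rightarrow> real"
    assume "\<forall>y\<in>UNIV. h y = h' y"
    then have "h = h'" by (simp add: fun_eq_iff)
    then show "lin_comb E x u h = lin_comb E x u h'" by simp
  next
    fix h assume "h \<notin> smooth_functions \<A> UNIV"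
    then have "E i x h = 0" for i using E[of i] by (simp add: tangent_space_def)
    then show "lin_comb E x u h = 0" by (simp add: lin_comb_def)
  qed
qed

text \<open>The smallness condition on \<open>X\<close> is an operator norm bound with respect to the metric at \<open>x\<close>. In
  the coordinates of a frame the metric gives a norm on a finite-dimensional space, equivalent to the
  Euclidean one; the comparison constants enter once, not once per factor, so the powers of the matrix
  still grow at most like \<open>r\<^sup>n\<close>.\<close>

lemma matrix_powers_bounded_by_metric:
  fixes \<A> :: "('m::topological_space, 'e::euclidean_space) chart set"
    and M :: "real^'n^'n" and E :: "'n \<Rightarrow> 'm vfield"
  assumes g: "riemannian_metric \<A> g" and E: "frame_at \<A> x E"
    and M: "\<And>u. sqrt (g x (lin_comb E x (M *v u)) (lin_comb E x (M *v u))) \<le>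
      r * sqrt (g x (lin_comb E x u) (lin_comb E x u))"
  obtains C where "0 \<le> r" "\<And>n. norm (mat_power M n) \<le> C * r ^ n"
proof -
  let ?l = "lin_comb E x"
  define b where "b u v = g x (?l u) (?l v)" for u v
  define p where "p u = sqrt (b u u)" for u
  note tangent = lin_comb_in_tangent_space[OF E]
  have l_add: "?l (u + v) = (\<lambda>h. 1 * ?l u h + 1 * ?l v h)" for u v
    by (simp add: lin_comb_def fun_eq_iff algebra_simps sum.distrib)
  have l_scale: "?l (a *\<^sub>R u) = (\<lambda>h. a * ?l u h + 0 * ?l u h)" for a u
    by (simp add: lin_comb_def fun_eq_iff sum_distrib_left algebra_simps)
  have l_inj: "u = 0" if "?l u = (\<lambda>h. 0)" for u
  proof -
    have "?l 0 = ?l u" using that by (simp add: lin_comb_def fun_eq_iff)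
    then show ?thesis using E tangent[of u] unfolding frame_at_def by metis
  qed
  have sym: "b u v = b v u" for u v
    using g tangent unfolding b_def riemannian_metric_def by blast
  have lin: "g x (\<lambda>h. a * ?l u h + c * ?l v h) (?l w) = a * b u w + c * b v w" for a c u v w
    using g tangent unfolding b_def riemannian_metric_def by blast
  have add: "b (u + v) w = b u w + b v w" for u v w
    unfolding b_def l_add by (simp only: lin) (simp add: b_def)
  have scale: "b (a *\<^sub>R u) w = a * b u w" for a u w
    unfolding b_def l_scale by (simp only: lin) (simp add: b_def)
  have "bilinear b"
    unfolding bilinear_def linear_iff using add scale sym by (metis real_scaleR_def)
  then have bb: "bounded_bilinear b" by (simp add: bilinear_conv_bounded_bilinear)
  have pos: "0 < b u u" if "u \<noteq> 0" for u
    using g tangent l_inj[of u] that unfolding b_def riemannian_metric_def by blast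
  have p_scale: "p (a *\<^sub>R u) = \<bar>a\<bar> * p u" for a u
  proof -
    have "b (a *\<^sub>R u) (a *\<^sub>R u) = a\<^sup>2 * b u u"
      by (simp only: scale[of a u] sym[of u "a *\<^sub>R u"]) (simp add: power2_eq_square)
    then show ?thesis by (simp add: p_def real_sqrt_mult)
  qed
  have p_nonneg: "0 \<le> p u" for u
    using pos[of u] scale[of 0 u u] by (cases "u = 0") (auto simp: p_def)
  \<comment> \<open>by compactness, the metric norm attains a positive minimum on the Euclidean unit sphere\<close>
  obtain v :: "real^'n" where v: "norm v = 1" "\<And>u. norm u = 1 \<Longrightarrow> p v \<le> p u"
  proof -
    have "continuous_on (sphere 0 1) p"
      unfolding p_def
      by (intro continuous_intros bounded_bilinear.continuous_on[OF bb] continuous_on_id)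
    moreover have "sphere (0 :: real^'n) 1 \<noteq> {}" by simp
    ultimately obtain v :: "real^'n" where "v \<in> sphere 0 1" "\<forall>u\<in>sphere 0 1. p v \<le> p u"
      using continuous_attains_inf[OF compact_sphere] by blast
    then show ?thesis using that by simp
  qed
  have pv: "0 < p v" using pos[of v] v(1) by (cases "v = 0") (auto simp: p_def)
  have lower: "p v * norm u \<le> p u" for u
  proof (cases "u = 0")
    case False
    then have "p v \<le> p ((1 / norm u) *\<^sub>R u)" by (intro v) simp
    with False show ?thesis by (simp add: p_scale field_simps)
  qed (simp add: p_nonneg)
  obtain K where K: "0 \<le> K" "\<And>u w. norm (b u w) \<le> norm u * norm w * K"
    using bounded_bilinear.nonneg_bounded[OF bb] by blast
  have upper: "p u \<le> sqrt K * norm u" for u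
  proof -
    have "b u u \<le> (norm u)\<^sup>2 * K" using K(2)[of u u] by (simp add: power2_eq_square)
    then have "p u \<le> sqrt ((norm u)\<^sup>2 * K)" unfolding p_def by (rule real_sqrt_le_mono)
    then show ?thesis by (simp add: real_sqrt_mult mult.commute)
  qed
  have step: "p (M *v u) \<le> r * p u" for u using M by (simp add: p_def b_def)
  have r: "0 \<le> r"
  proof -
    have "0 \<le> r * p v" using order.trans[OF p_nonneg step] .
    then show ?thesis using pv by (simp add: zero_le_mult_iff)
  qed
  have power: "p (mat_power M n *v u) \<le> r ^ n * p u" for n u
  proof (induction n)
    case (Suc n)
    have "p (mat_power M (Suc n) *v u) \<le> r * p (mat_power M n *v u)"
      using step by (simp add: matrix_vector_mul_assoc[symmetric])
    also have "\<dots> \<le> r * (r ^ n * p u)" by (rule mult_left_mono[OF Suc.IH r])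
    finally show ?case by simp
  qed simp
  have bound: "norm (mat_power M n) \<le> sqrt K / p v * norm (\<chi> i j. 1 :: real^'n^'n) * r ^ n" for n
  proof -
    have entry: "\<bar>mat_power M n $ i $ j\<bar> \<le> sqrt K / p v * r ^ n" for i j
    proof -
      let ?w = "mat_power M n *v axis j 1"
      have "mat_power M n $ i $ j = ?w $ i" by (simp add: matrix_vector_mul_component inner_axis)
      then have "p v * \<bar>mat_power M n $ i $ j\<bar> \<le> p v * norm ?w"
        using pv component_le_norm_cart[of ?w i] by (simp add: mult_left_mono)
      also have "\<dots> \<le> r ^ n * p (axis j 1)" using lower power order.trans by blast
      also have "\<dots> \<le> r ^ n * (sqrt K * norm (axis j 1 :: real^'n))"
        by (rule mult_left_mono[OF upper zero_le_power[OF r]])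
      finally show ?thesis using pv by (simp add: field_simps)
    qed
    have "norm (mat_power M n) \<le> (sqrt K / p v * r ^ n) * norm (\<chi> i j. 1 :: real^'n^'n)"
      by (rule norm_matrix_mono) (use entry K r pv in auto)
    then show ?thesis by (simp add: mult_ac)
  qed
  show ?thesis by (rule that[OF r bound])
qed

lemma mat_degree_part_endo_form1: "mat_degree_part d (endo_form1 E x S) = (if d = 1 then endo_form1 E x S else 0)"
  by (simp add: vec_eq_iff endo_form1_def)

lemma mat_degree_part_endo_form2: "mat_degree_part d (endo_form2 E x S) = (if d = 2 then endo_form2 E x S else 0)"
proof -
  have "degree_part d (ext_gen a * ext_gen b) = (if d = 2 then ext_gen a * ext_gen b else 0)" for a b :: 'a
  proof -
    have "degree_part d (ext_gen a * ext_gen b) =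
      (\<Sum>i\<le>d. if i = 1 then (if d = 2 then ext_gen a * ext_gen b else 0) else 0)"
      unfolding degree_part_mult by (intro sum.cong refl) auto
    then show ?thesis by simp
  qed
  then show ?thesis by (simp add: vec_eq_iff endo_form2_def)
qed

text \<open>Both sides integrate the same coefficients in degree \<open>d\<close>; in other degrees the right hand side
  integrates 0.\<close>

lemma degree_part_integral01: "degree_part d (integral01 w) = integral01 (\<lambda>t. degree_part d (w t))"
  by (rule exterior_eqI) (simp add: integral01_def)

lemma integral01_cong: "(\<And>t. t \<in> {0..1} \<Longrightarrow> v t = w t) \<Longrightarrow> integral01 v = integral01 w"
  unfolding integral01_def by (intro arg_cong[of _ _ Ext] ext integral_cong) simp

theorem proposition9p1:
  fixes \<A> :: "('m::t2_space, real^'n::{finite,linorder}) chart set"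
    and k :: 'n
    and \<G> :: "('g::t2_space, 'z) monoid_scheme"
    and \<B> :: "('g, 'e::euclidean_space) chart set"
    and V :: "'e set"
    and act :: "'g \<Rightarrow> 'm \<Rightarrow> 'm"
    and c :: "'m \<times> real \<Rightarrow> 'm"
    and g g0 :: "'m metric_tensor"
    and D1 D0 :: "'m connection"
    and X :: "'g tangent_vector"
    and X\<^sub>M :: "'m vfield"
    and x :: 'm
    and E :: "'n \<Rightarrow> 'm vfield"
  assumes "smooth_atlas (half_space k) \<A>" and "compact (UNIV :: 'm set)" and "even CARD('n)"
    and "lie_group V \<B> \<G>" and "compact (UNIV :: 'g set)"
    and "smooth_action \<A> \<B> \<G> act"
    and "equivariant_collar k \<A> act c"
    and "riemannian_metric \<A> g" and "invariant_metric \<A> act g"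
    and "riemannian_metric \<A> g0" and "invariant_metric \<A> act g0"
    and "product_near_boundary k \<A> c g0" and "same_boundary_metric k \<A> g0 g"
    and "levi_civita \<A> g D1" and "levi_civita \<A> g0 D0"
    and "X \<in> lie_algebra \<B> \<G>" and "X\<^sub>M = fundamental_vfield \<A> \<B> \<G> act X"
    and "small_for_convergence \<A> g D1 D0 X\<^sub>M"
    and "frame_at \<A> x E"
  shows "degree_part 3 (TL E x D1 D0 X\<^sub>M) =
    integral01 (\<lambda>t.
      let A = nabla_form E x (conn_path D1 D0 t) X\<^sub>M;
          R = curvature_form E x (conn_path D1 D0 t);
          \<Theta> = endo_form1 E x (conn_diff D1 D0)
      in exp (trace (mat_fun L_f A)) *
         (trace (\<Theta> ** mat_fun (deriv L_f) A) * trace (mat_fun (deriv L_f) A ** R)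
          + trace (second_quot L_f A \<Theta> ** R)))"
  unfolding TL_def degree_part_integral01 Let_def
proof (rule integral01_cong)
  fix t :: real
  assume t: "t \<in> {0..1}"
  define M where "M = endo_matrix E x (\<lambda>Y. conn_path D1 D0 t Y X\<^sub>M)"
  obtain r where r: "ereal r < conv_radius (taylor_coeff L_f)"
    "\<And>u. sqrt (g x (lin_comb E x (M *v u)) (lin_comb E x (M *v u))) \<le>
      r * sqrt (g x (lin_comb E x u) (lin_comb E x u))"
    using \<open>small_for_convergence \<A> g D1 D0 X\<^sub>M\<close> \<open>frame_at \<A> x E\<close> t
    unfolding small_for_convergence_def Let_def M_def by blast
  obtain C where C: "0 \<le> r" "\<And>n. norm (mat_power M n) \<le> C * r ^ n"
    using matrix_powers_bounded_by_metric[where M = M and r = r and E = E, OF \<open>riemannian_metric \<A> g\<close> \<open>frame_at \<A> x E\<close> r(2)] by blast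
  have A: "nabla_form E x (conn_path D1 D0 t) X\<^sub>M = map_matrix of_real M"
    by (simp add: nabla_form_def endo_form0_def M_def vec_eq_iff)
  define R where "R = curvature_form E x (conn_path D1 D0 t)"
  define \<Theta> where "\<Theta> = endo_form1 E x (conn_diff D1 D0)"
  have R: "mat_degree_part d R = (if d = 2 then R else 0)" and \<Theta>: "mat_degree_part d \<Theta> = (if d = 1 then \<Theta> else 0)" for d
    by (simp_all only: R_def \<Theta>_def curvature_form_def mat_degree_part_endo_form1 mat_degree_part_endo_form2)
  show "degree_part 3
      (exp (trace (mat_fun L_f (equivariant_curvature E x (conn_path D1 D0 t) X\<^sub>M))) *
       trace (endo_form1 E x (conn_diff D1 D0) **
         mat_fun (deriv L_f) (equivariant_curvature E x (conn_path D1 D0 t) X\<^sub>M))) =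
    exp (trace (mat_fun L_f (nabla_form E x (conn_path D1 D0 t) X\<^sub>M))) *
      (trace (endo_form1 E x (conn_diff D1 D0) ** mat_fun (deriv L_f) (nabla_form E x (conn_path D1 D0 t) X\<^sub>M)) *
        trace (mat_fun (deriv L_f) (nabla_form E x (conn_path D1 D0 t) X\<^sub>M) **
          curvature_form E x (conn_path D1 D0 t)) +
       trace (second_quot L_f (nabla_form E x (conn_path D1 D0 t) X\<^sub>M) (endo_form1 E x (conn_diff D1 D0)) **
         curvature_form E x (conn_path D1 D0 t)))"
    unfolding equivariant_curvature_def A R_def[symmetric] \<Theta>_def[symmetric]
    using degree_3_transgression_integrand[where A = M and R = R and \<Theta> = \<Theta> and p = L_f,
        OF C(2,1) r(1) taylor_coeff_L_f_odd R \<Theta>] .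
qed

end
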